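(* Let $R$ be a unital ring and let $E$ be a directed graph with $E^0\neq\emptyset$. Then the Leavitt path algebra $L_R(E)$, with its canonical $\mathbb{Z}$-grading, is graded von Neumann regular if and only if $R$ is von Neumann regular.
   Context: Rings are associative, not necessarily unital and not necessarily commutative; a ring is called unital if it has a non-zero multiplicative identity. A ring $R$ is von Neumann regular if for every $x\in R$ there is $y\in R$ with $x=xyx$. A $\mathbb{Z}$-graded ring $S=\bigoplus_{i\in\mathbb{Z}}S_i$ is graded von Neumann regular if for every $i\in\mathbb{Z}$ and $a\in S_i$ there is $s\in S$ with $a=asa$. A directed graph $E=(E^0,E^1,s,r)$ consists of a vertex set $E^0$, an edge set $E^1$ (of arbitrary cardinality) and maps $s,r\colon E^1\to E^0$ (source and range). A vertex $v$ is regular if $s^{-1}(v)$ is non-empty and finite; $\mathrm{Reg}(E)$ is the set of regular vertices. The Leavitt path algebra $L_R(E)$ is the (not necessarily unital) free $R$-algebra generated by the symbols $\{v\mid v\in E^0\}\cup\{f\mid f\in E^1\}\cup\{f^*\mid f\in E^1\}$, where elements of $R$ commute with the generators, subject to the relations: (i) $vv'=\delta_{v,v'}v$ for $v,v'\in E^0$; (ii) $s(f)f=f=fr(f)$ for $f\in E^1$; (iii) $r(f)f^*=f^*=f^*s(f)$ for $f\in E^1$; (iv) $f^*f'=\delta_{f,f'}r(f)$ for $f,f'\in E^1$; (v) $v=\sum_{f\in s^{-1}(v)}ff^*$ for all $v\in\mathrm{Reg}(E)$. A path is a sequence of edges $\alpha=f_1\cdots f_n$ with $r(f_i)=s(f_{i+1})$,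 of length $\mathrm{len}(\alpha)=n$; vertices are paths of length $0$. Put $\alpha^*=f_n^*\cdots f_1^*$ and $v^*=v$. The canonical $\mathbb{Z}$-grading is $L_R(E)_i=\mathrm{Span}_R\{\alpha\beta^*\mid \alpha,\beta \text{ paths},\ \mathrm{len}(\alpha)-\mathrm{len}(\beta)=i\}$. *)

theory Defs
  imports
    "HOL-Library.Poly_Mapping"
    "Graph_Theory.Arc_Walk"
begin

section \<open>Von Neumann regularity\<close>

definition von_neumann_regular :: "'r::ring itself \<Rightarrow> bool" where
  "von_neumann_regular _ \<longleftrightarrow> (\<forall>x::'r. \<exists>y. x = x * y * x)"

text \<open>
  A graded ring is given here by its carrier \<open>S\<close>, its multiplication \<open>mul\<close> and its family of
  homogeneous components \<open>D\<close>.  Only these data enter the definition; the witness \<open>s\<close> ranges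
  over the whole ring.
\<close>

definition graded_von_neumann_regular ::
    "'a set \<Rightarrow> ('a \<Rightarrow> 'a \<Rightarrow> 'a) \<Rightarrow> (int \<Rightarrow> 'a set) \<Rightarrow> bool" where
  "graded_von_neumann_regular S mul D \<longleftrightarrow>
     (\<forall>i. \<forall>a \<in> D i. \<exists>s \<in> S. a = mul (mul a s) a)"


section \<open>The free algebra on vertices, edges and ghost edges\<close>

text \<open>
  Words form a monoid under concatenation, so that \<open>'x list \<Rightarrow>\<^sub>0 'r\<close> is, with the convolution
  product of \<^theory>\<open>HOL-Library.Poly_Mapping\<close>, the free unital \<open>'r\<close>-algebra on \<open>'x\<close> whose
  generators commute with the coefficients: the product of \<open>single u a\<close> and \<open>single w b\<close> is
  \<open>single (u @ w) (a * b)\<close>.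
\<close>

instantiation list :: (type) monoid_add
begin

definition zero_list_def: "0 = ([] :: 'a list)"

definition plus_list_def: "u + w = (u @ w :: 'a list)"

instance
  by standard (simp_all add: zero_list_def plus_list_def)

end

datatype ('v, 'e) generator = Vert 'v | Edge 'e | Ghost 'e

type_synonym ('v, 'e, 'r) free_alg = "('v, 'e) generator list \<Rightarrow>\<^sub>0 'r"

definition generators :: "('v, 'e) pre_digraph \<Rightarrow> ('v, 'e) generator set" where
  "generators E = Vert ` verts E \<union> Edge ` arcs E \<union> Ghost ` arcs E"

text \<open>The non-unital free algebra: no constant term, i.e. only non-empty words occur.\<close>

definition free_algebra :: "('v, 'e) pre_digraph \<Rightarrow> ('v, 'e, 'r::ring_1) free_alg set" where
  "free_algebra E =
     {p. \<forall>w \<in> Poly_Mapping.keys p. w \<noteq> [] \<and> set w \<subseteq> generators E}"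

definition scalar :: "'r::ring_1 \<Rightarrow> ('v, 'e, 'r) free_alg" where
  "scalar c = Poly_Mapping.single [] c"

definition gen :: "('v, 'e) generator \<Rightarrow> ('v, 'e, 'r::ring_1) free_alg" where
  "gen g = Poly_Mapping.single [g] 1"


section \<open>Leavitt path algebras\<close>

definition regular_vertices :: "('v, 'e) pre_digraph \<Rightarrow> 'v set" where
  "regular_vertices E = {v \<in> verts E. out_arcs E v \<noteq> {} \<and> finite (out_arcs E v)}"

inductive_set lpa_relators ::
    "('v, 'e) pre_digraph \<Rightarrow> ('v, 'e, 'r::ring_1) free_alg set"
  for E :: "('v, 'e) pre_digraph" where
  vert_vert:
    "\<lbrakk>v \<in> verts E; v' \<in> verts E\<rbrakk> \<Longrightarrow>
       gen (Vert v) * gen (Vert v') - (if v = v' then gen (Vert v) else 0) \<in> lpa_relators E"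
| tail_edge:
    "f \<in> arcs E \<Longrightarrow> gen (Vert (tail E f)) * gen (Edge f) - gen (Edge f) \<in> lpa_relators E"
| edge_head:
    "f \<in> arcs E \<Longrightarrow> gen (Edge f) * gen (Vert (head E f)) - gen (Edge f) \<in> lpa_relators E"
| head_ghost:
    "f \<in> arcs E \<Longrightarrow> gen (Vert (head E f)) * gen (Ghost f) - gen (Ghost f) \<in> lpa_relators E"
| ghost_tail:
    "f \<in> arcs E \<Longrightarrow> gen (Ghost f) * gen (Vert (tail E f)) - gen (Ghost f) \<in> lpa_relators E"
| ghost_edge:
    "\<lbrakk>f \<in> arcs E; f' \<in> arcs E\<rbrakk> \<Longrightarrow>
       gen (Ghost f) * gen (Edge f') - (if f = f' then gen (Vert (head E f)) else 0)
         \<in> lpa_relators E"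
| regular:
    "v \<in> regular_vertices E \<Longrightarrow>
       gen (Vert v) - (\<Sum>f \<in> out_arcs E v. gen (Edge f) * gen (Ghost f)) \<in> lpa_relators E"

text \<open>
  The ideal of the non-unital algebra \<open>free_algebra E\<close> generated by the relators.  As there is no
  unit, closure under the coefficient ring has to be demanded separately, and on both sides since
  \<open>'r\<close> need not be commutative.  Negatives are obtained from the scalar \<open>-1\<close>.
\<close>

inductive_set lpa_ideal ::
    "('v, 'e) pre_digraph \<Rightarrow> ('v, 'e, 'r::ring_1) free_alg set"
  for E :: "('v, 'e) pre_digraph" where
  relator: "p \<in> lpa_relators E \<Longrightarrow> p \<in> lpa_ideal E"
| zero: "0 \<in> lpa_ideal E"
| add: "\<lbrakk>p \<in> lpa_ideal E; q \<in> lpa_ideal E\<rbrakk> \<Longrightarrow> p + q \<in> lpa_ideal E"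
| scale_left: "p \<in> lpa_ideal E \<Longrightarrow> scalar c * p \<in> lpa_ideal E"
| scale_right: "p \<in> lpa_ideal E \<Longrightarrow> p * scalar c \<in> lpa_ideal E"
| mult_left: "\<lbrakk>p \<in> lpa_ideal E; q \<in> free_algebra E\<rbrakk> \<Longrightarrow> q * p \<in> lpa_ideal E"
| mult_right: "\<lbrakk>p \<in> lpa_ideal E; q \<in> free_algebra E\<rbrakk> \<Longrightarrow> p * q \<in> lpa_ideal E"

definition lpa_cong ::
    "('v, 'e) pre_digraph \<Rightarrow> (('v, 'e, 'r::ring_1) free_alg \<times> ('v, 'e, 'r) free_alg) set" where
  "lpa_cong E = {(p, q). p \<in> free_algebra E \<and> q \<in> free_algebra E \<and> p - q \<in> lpa_ideal E}"

type_synonym ('v, 'e, 'r) lpa_elem = "('v, 'e, 'r) free_alg set"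

text \<open>
  \<open>lpa TYPE('r) E\<close> is the Leavitt path algebra of \<open>E\<close> with coefficients in \<open>'r\<close>: the quotient of
  the free algebra by the ideal above.  Its operations are the ones induced on congruence classes.
\<close>

definition lpa :: "'r::ring_1 itself \<Rightarrow> ('v, 'e) pre_digraph \<Rightarrow> ('v, 'e, 'r) lpa_elem set" where
  "lpa _ E = free_algebra E // lpa_cong E"

definition lpa_class ::
    "('v, 'e) pre_digraph \<Rightarrow> ('v, 'e, 'r::ring_1) free_alg \<Rightarrow> ('v, 'e, 'r) lpa_elem" where
  "lpa_class E p = lpa_cong E `` {p}"

definition lpa_add ::
    "('v, 'e) pre_digraph \<Rightarrow> ('v, 'e, 'r::ring_1) lpa_elem \<Rightarrow> ('v, 'e, 'r) lpa_elem
       \<Rightarrow> ('v, 'e, 'r) lpa_elem" where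
  "lpa_add E X Y = (\<Union>p \<in> X. \<Union>q \<in> Y. lpa_class E (p + q))"

definition lpa_mult ::
    "('v, 'e) pre_digraph \<Rightarrow> ('v, 'e, 'r::ring_1) lpa_elem \<Rightarrow> ('v, 'e, 'r) lpa_elem
       \<Rightarrow> ('v, 'e, 'r) lpa_elem" where
  "lpa_mult E X Y = (\<Union>p \<in> X. \<Union>q \<in> Y. lpa_class E (p * q))"

definition lpa_scale ::
    "('v, 'e) pre_digraph \<Rightarrow> 'r::ring_1 \<Rightarrow> ('v, 'e, 'r) lpa_elem \<Rightarrow> ('v, 'e, 'r) lpa_elem" where
  "lpa_scale E c X = (\<Union>p \<in> X. lpa_class E (scalar c * p))"


section \<open>The canonical grading\<close>

text \<open>
  A path is given by its source \<open>u\<close> and its list of edges \<open>\<alpha>\<close>, subject to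
  \<open>pre_digraph.awalk E u \<alpha> w\<close>; the empty list stands for the vertex \<open>u\<close>, a path of length 0.
\<close>

definition lpa_path ::
    "('v, 'e) pre_digraph \<Rightarrow> 'v \<Rightarrow> 'e awalk \<Rightarrow> ('v, 'e, 'r::ring_1) lpa_elem" where
  "lpa_path E u \<alpha> =
     lpa_class E (Poly_Mapping.single (if \<alpha> = [] then [Vert u] else map Edge \<alpha>) 1)"

definition lpa_path_star ::
    "('v, 'e) pre_digraph \<Rightarrow> 'v \<Rightarrow> 'e awalk \<Rightarrow> ('v, 'e, 'r::ring_1) lpa_elem" where
  "lpa_path_star E u \<alpha> =
     lpa_class E (Poly_Mapping.single (if \<alpha> = [] then [Vert u] else map Ghost (rev \<alpha>)) 1)"

inductive_set lpa_span ::
    "('v, 'e) pre_digraph \<Rightarrow> ('v, 'e, 'r::ring_1) lpa_elem set \<Rightarrow> ('v, 'e, 'r) lpa_elem set"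
  for E :: "('v, 'e) pre_digraph" and B :: "('v, 'e, 'r::ring_1) lpa_elem set" where
  zero: "lpa_class E 0 \<in> lpa_span E B"
| scale: "X \<in> B \<Longrightarrow> lpa_scale E c X \<in> lpa_span E B"
| add: "\<lbrakk>X \<in> lpa_span E B; Y \<in> lpa_span E B\<rbrakk> \<Longrightarrow> lpa_add E X Y \<in> lpa_span E B"

text \<open>
  No condition relates the ranges of the two paths: if they differ, the product is zero in the
  Leavitt path algebra.
\<close>

definition lpa_component ::
    "('v, 'e) pre_digraph \<Rightarrow> int \<Rightarrow> ('v, 'e, 'r::ring_1) lpa_elem set" where
  "lpa_component E i = lpa_span E
     {lpa_mult E (lpa_path E u \<alpha>) (lpa_path_star E u' \<beta>) | u \<alpha> w u' \<beta> w'.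
        pre_digraph.awalk E u \<alpha> w \<and> pre_digraph.awalk E u' \<beta> w' \<and>
        int (length \<alpha>) - int (length \<beta>) = i}"


section \<open>The operations on classes are well defined\<close>

lemma free_algebra_zero: "0 \<in> free_algebra E"
  by (simp add: free_algebra_def)

lemma free_algebra_add:
  assumes "p \<in> free_algebra E" "q \<in> free_algebra E"
  shows "p + q \<in> free_algebra E"
  using assms keys_add[of p q] by (fastforce simp: free_algebra_def)

lemma free_algebra_diff:
  assumes "p \<in> free_algebra E" "q \<in> free_algebra E"
  shows "p - q \<in> free_algebra E"
  using assms keys_diff[of p q] by (fastforce simp: free_algebra_def)

lemma free_algebra_mult:
  assumes "p \<in> free_algebra E" "q \<in> free_algebra E"
  shows "p * q \<in> free_algebra E"
  using assms keys_mult[of p q] by (fastforce simp: free_algebra_def plus_list_def)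

lemma free_algebra_scale:
  assumes "p \<in> free_algebra E"
  shows "scalar c * p \<in> free_algebra E"
  using assms keys_mult[of "scalar c" p]
  by (fastforce simp: free_algebra_def plus_list_def scalar_def split: if_splits)

lemma lpa_ideal_uminus:
  assumes "p \<in> lpa_ideal E"
  shows "- p \<in> lpa_ideal E"
proof -
  have "scalar (- 1) = (- 1 :: ('a, 'b, 'c) free_alg)"
    by (metis scalar_def single_one single_uminus zero_list_def)
  then show ?thesis
    using lpa_ideal.scale_left[OF assms, of "- 1"] by simp
qed

lemma lpa_ideal_diff:
  assumes "p \<in> lpa_ideal E" "q \<in> lpa_ideal E"
  shows "p - q \<in> lpa_ideal E"
  using lpa_ideal.add[OF assms(1) lpa_ideal_uminus[OF assms(2)]] by simp

lemma equiv_lpa_cong: "equiv (free_algebra E) (lpa_cong E)"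
proof (rule equivI)
  show "lpa_cong E \<subseteq> free_algebra E \<times> free_algebra E"
    by (auto simp: lpa_cong_def)
  show "refl_on (free_algebra E) (lpa_cong E)"
    by (auto simp: refl_on_def lpa_cong_def lpa_ideal.zero)
  show "sym (lpa_cong E)"
    using lpa_ideal_uminus by (fastforce simp: sym_def lpa_cong_def)
  show "trans (lpa_cong E)"
  proof (rule transI)
    fix p q s assume "(p, q) \<in> lpa_cong E" "(q, s) \<in> lpa_cong E"
    then show "(p, s) \<in> lpa_cong E"
      using lpa_ideal.add[of "p - q" E "q - s"] by (simp add: lpa_cong_def)
  qed
qed

lemma lpa_class_eq_iff:
  assumes "p \<in> free_algebra E" "q \<in> free_algebra E"
  shows "lpa_class E p = lpa_class E q \<longleftrightarrow> p - q \<in> lpa_ideal E"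
  using assms eq_equiv_class_iff[OF equiv_lpa_cong] by (auto simp: lpa_class_def lpa_cong_def)

lemma lpa_class_add:
  fixes p q :: "('v, 'e, 'r::ring_1) free_alg"
  assumes "p \<in> free_algebra E" "q \<in> free_algebra E"
  shows "lpa_add E (lpa_class E p) (lpa_class E q) = lpa_class E (p + q)"
  unfolding lpa_add_def lpa_class_def
proof (rule UN_equiv_class2[OF equiv_lpa_cong equiv_lpa_cong _ assms])
  show "congruent2 (lpa_cong E) (lpa_cong E) (\<lambda>(p :: ('v, 'e, 'r) free_alg) q. lpa_cong E `` {p + q})"
  proof (rule congruent2I')
    fix p p' q q' :: "('v, 'e, 'r) free_alg"
    assume "(p, p') \<in> lpa_cong E" "(q, q') \<in> lpa_cong E"
    then have "(p + q, p' + q') \<in> lpa_cong E"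
      using lpa_ideal.add[of "p - p'" E "q - q'"]
      by (auto simp: lpa_cong_def free_algebra_add algebra_simps)
    then show "lpa_cong E `` {p + q} = lpa_cong E `` {p' + q'}"
      by (rule equiv_class_eq[OF equiv_lpa_cong])
  qed
qed

lemma lpa_class_mult:
  fixes p q :: "('v, 'e, 'r::ring_1) free_alg"
  assumes "p \<in> free_algebra E" "q \<in> free_algebra E"
  shows "lpa_mult E (lpa_class E p) (lpa_class E q) = lpa_class E (p * q)"
  unfolding lpa_mult_def lpa_class_def
proof (rule UN_equiv_class2[OF equiv_lpa_cong equiv_lpa_cong _ assms])
  show "congruent2 (lpa_cong E) (lpa_cong E) (\<lambda>(p :: ('v, 'e, 'r) free_alg) q. lpa_cong E `` {p * q})"
  proof (rule congruent2I')
    fix p p' q q' :: "('v, 'e, 'r) free_alg"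
    assume a: "(p, p') \<in> lpa_cong E" "(q, q') \<in> lpa_cong E"
    then have "(p - p') * q + p' * (q - q') \<in> lpa_ideal E"
      by (intro lpa_ideal.add lpa_ideal.mult_right[of "p - p'"] lpa_ideal.mult_left[of "q - q'"])
        (auto simp: lpa_cong_def)
    then have "(p * q, p' * q') \<in> lpa_cong E"
      using a by (auto simp: lpa_cong_def free_algebra_mult algebra_simps)
    then show "lpa_cong E `` {p * q} = lpa_cong E `` {p' * q'}"
      by (rule equiv_class_eq[OF equiv_lpa_cong])
  qed
qed

lemma lpa_class_scale:
  fixes p :: "('v, 'e, 'r::ring_1) free_alg"
  assumes "p \<in> free_algebra E"
  shows "lpa_scale E c (lpa_class E p) = lpa_class E (scalar c * p)"
  unfolding lpa_scale_def lpa_class_def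
proof (rule UN_equiv_class[OF equiv_lpa_cong _ assms])
  show "congruent (lpa_cong E) (\<lambda>p :: ('v, 'e, 'r) free_alg. lpa_cong E `` {scalar c * p})"
  proof (rule congruentI)
    fix p p' :: "('v, 'e, 'r) free_alg"
    assume "(p, p') \<in> lpa_cong E"
    then have "(scalar c * p, scalar c * p') \<in> lpa_cong E"
      using lpa_ideal.scale_left[of "p - p'" E c]
      by (auto simp: lpa_cong_def free_algebra_scale algebra_simps)
    then show "lpa_cong E `` {scalar c * p} = lpa_cong E `` {scalar c * p'}"
      by (rule equiv_class_eq[OF equiv_lpa_cong])
  qed
qed

end

theory Submission
  imports Defs "HOL-Library.Product_Lexorder"
begin

text \<open>
  If the algebra is graded regular, let it act on the functions \<open>X \<rightarrow> R\<close>, where \<open>X\<close> is the disjoint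
  union of copies \<open>X\<^sub>v\<close> of an infinite set, one per vertex \<open>v\<close>, with \<open>X\<^sub>v\<close> identified with the
  disjoint union of the sets \<open>X\<^bsub>r(f)\<^esub>\<close>, \<open>s(f) = v\<close>, whenever \<open>v\<close> emits an edge.  The action is left
  multiplication on coefficients and hence right \<open>R\<close>-linear, so applying \<open>xv = xv \<cdot> s \<cdot> xv\<close> to the
  indicator function of a point of \<open>X\<^sub>v\<close> gives \<open>x = x y x\<close>, where \<open>y\<close> is a matrix coefficient of \<open>s\<close>.

  Conversely, order the monomials \<open>\<alpha>\<beta>\<^sup>*\<close> of degree \<open>i\<close> lexicographically by the length of \<open>\<beta>\<close>, then
  by \<open>\<alpha>\<close>, then by \<open>\<beta>\<close>.  If \<open>e\<^sub>j \<le> e\<^sub>l, e\<^sub>m\<close>, then \<open>e\<^sub>l e\<^sub>j\<^sup>* e\<^sub>m\<close> is zero or a monomial larger than \<open>e\<^sub>j\<close>,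
  except for \<open>e\<^sub>j e\<^sub>j\<^sup>* e\<^sub>j = e\<^sub>j\<close>.  Therefore, if \<open>c e\<^sub>j\<close> is the smallest term of \<open>p\<close> and \<open>c = c d c\<close>, all
  terms of \<open>p - p (d e\<^sub>j\<^sup>*) p\<close> are larger than \<open>e\<^sub>j\<close>.  All this takes place among finitely many monomials, and
  von Neumann's observation that \<open>p\<close> is regular if \<open>p - p y p\<close> is finishes the induction.
\<close>

section \<open>Words in the free algebra\<close>

text \<open>Updating at a fresh key is the same as adding a monomial there, so a property closed
  under sums needs to be checked on monomials only.\<close>

lemma poly_mapping_single_add_induct [case_names single add]:
  assumes single: "\<And>k c. P (Poly_Mapping.single k c)"
    and add: "\<And>p q. P p \<Longrightarrow> P q \<Longrightarrow> P (p + q)"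
  shows "P (p :: 'a \<Rightarrow>\<^sub>0 'b::comm_monoid_add)"
proof (induction p rule: Poly_Mapping.update_induct)
  case const
  \<comment> \<open>The empty mapping is the monomial with coefficient 0 at an arbitrary
    key.\<close>
  show ?case using single[of undefined 0] by simp
next
  case (update f a b)
  have "Poly_Mapping.update a b f = f + Poly_Mapping.single a b"
    using update.hyps
    by (intro poly_mapping_eqI)
      (auto simp: lookup_update lookup_add lookup_single when_def in_keys_iff)
  then show ?case using add single update by metis
qed

lemma single_word_mult:
  "Poly_Mapping.single u a * Poly_Mapping.single w b = Poly_Mapping.single (u @ w) (a * b)"
  by (simp add: mult_single plus_list_def)

lemma scalar_mult_single:
  "scalar c * Poly_Mapping.single w a = Poly_Mapping.single w (c * a)"
  by (simp add: scalar_def single_word_mult)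

lemma gen_mult_gen: "gen g * gen h = Poly_Mapping.single [g, h] 1"
  by (simp add: gen_def single_word_mult)

lemma single_in_free_algebra:
  "w \<noteq> [] \<Longrightarrow> set w \<subseteq> generators E \<Longrightarrow> Poly_Mapping.single w c \<in> free_algebra E"
  by (simp add: free_algebra_def)

lemma generators_simps [simp]:
  "Vert v \<in> generators E \<longleftrightarrow> v \<in> verts E"
  "Edge f \<in> generators E \<longleftrightarrow> f \<in> arcs E"
  "Ghost f \<in> generators E \<longleftrightarrow> f \<in> arcs E"
  by (auto simp: generators_def)

lemma free_algebra_scale_right:
  assumes "p \<in> free_algebra E"
  shows "p * scalar c \<in> free_algebra E"
  using assms keys_mult[of p "scalar c"]
  by (fastforce simp: free_algebra_def plus_list_def scalar_def split: if_splits)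

lemma gen_in_free_algebra: "g \<in> generators E \<Longrightarrow> gen g \<in> free_algebra E"
  unfolding gen_def by (rule single_in_free_algebra) simp_all

lemma free_algebra_sum:
  "(\<And>a. a \<in> A \<Longrightarrow> p a \<in> free_algebra E) \<Longrightarrow> sum p A \<in> free_algebra E"
  by (induction A rule: infinite_finite_induct) (auto intro: free_algebra_zero free_algebra_add)


section \<open>Representations on functions\<close>

text \<open>
  The functions \<open>enc v\<close> and \<open>dec v\<close> are mutually inverse bijections between \<open>out_arcs E v \<times> 'y\<close> and \<open>'y\<close>
  for every \<open>v\<close> that is not a sink; nothing is required of them at sinks.
\<close>

locale branching_system = wf_digraph E for E :: "('v, 'e) pre_digraph" +
  fixes dec :: "'v \<Rightarrow> 'y \<Rightarrow> 'e \<times> 'y" and enc :: "'v \<Rightarrow> 'e \<times> 'y \<Rightarrow> 'y"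
  assumes dec_enc: "f \<in> arcs E \<Longrightarrow> dec (tail E f) (enc (tail E f) (f, y)) = (f, y)"
    and dec_arc: "out_arcs E v \<noteq> {} \<Longrightarrow> fst (dec v y) \<in> out_arcs E v"
    and enc_dec: "out_arcs E v \<noteq> {} \<Longrightarrow> enc v (dec v y) = y"
begin

text \<open>The points \<open>(v, y)\<close> form the set X_v of the overview. \<open>Edge f\<close>
  carries a function on X_r(f) to the part of X_s(f) that \<open>dec\<close> labels by
  \<open>f\<close>, \<open>Ghost f\<close> carries it back, and both give 0 elsewhere.\<close>

primrec gen_act :: "('v, 'e) generator \<Rightarrow> ('v \<times> 'y \<Rightarrow> 'r::ring_1) \<Rightarrow> 'v \<times> 'y \<Rightarrow> 'r" where
  "gen_act (Vert v) h = (\<lambda>(u, y). if u = v then h (u, y) else 0)"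
| "gen_act (Edge f) h = (\<lambda>(u, y).
     if u = tail E f \<and> fst (dec u y) = f then h (head E f, snd (dec u y)) else 0)"
| "gen_act (Ghost f) h = (\<lambda>(u, y).
     if u = head E f then h (tail E f, enc (tail E f) (f, y)) else 0)"

primrec word_act :: "('v, 'e) generator list \<Rightarrow> ('v \<times> 'y \<Rightarrow> 'r::ring_1) \<Rightarrow> 'v \<times> 'y \<Rightarrow> 'r" where
  "word_act [] h = h"
| "word_act (g # w) h = gen_act g (word_act w h)"

definition act :: "('v, 'e, 'r::ring_1) free_alg \<Rightarrow> ('v \<times> 'y \<Rightarrow> 'r) \<Rightarrow> 'v \<times> 'y \<Rightarrow> 'r" where
  "act p h z = (\<Sum>w\<in>Poly_Mapping.keys p. Poly_Mapping.lookup p w * word_act w h z)"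

section \<open>Linearity and multiplicativity of the action\<close>

lemma word_act_append: "word_act (u @ w) h = word_act u (word_act w h)"
  by (induction u) simp_all

text \<open>Generators only move values or replace them by 0. Commuting with left multiplication
  makes \<open>act\<close> multiplicative; commuting with right multiplication makes it right
  R-linear.\<close>

lemma word_act_linear:
  "word_act w (\<lambda>z. a * h z) = (\<lambda>z. a * word_act w h z)"
  "word_act w (\<lambda>z. h z * a) = (\<lambda>z. word_act w h z * a)"
  "word_act w (\<lambda>z. h z + k z) = (\<lambda>z. word_act w h z + word_act w k z)"
  "word_act w (\<lambda>z. 0) = (\<lambda>z. 0)"
proof (induction w)
  case (Cons g w)
  {
    case 1 show ?case unfolding word_act.simps Cons by (cases g) auto
  next
    case 2 show ?case unfolding word_act.simps Cons by (cases g) auto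
  next
    case 3 show ?case unfolding word_act.simps Cons by (cases g) auto
  next
    case 4 show ?case unfolding word_act.simps Cons by (cases g) auto
  }
qed simp_all

lemma act_single: "act (Poly_Mapping.single w c) h z = c * word_act w h z"
  by (simp add: act_def)

lemma act_zero [simp]: "act 0 h z = 0"
  by (simp add: act_def)

lemma act_add: "act (p + q) h z = act p h z + act q h z"
  unfolding act_def by (rule setsum_keys_plus_distrib) (simp_all add: distrib_right)

lemma act_diff: "act (p - q) h z = act p h z - act q h z"
  using act_add[of "p - q" q h z] by (simp add: algebra_simps)

lemma act_sum: "act (sum p A) h z = (\<Sum>a\<in>A. act (p a) h z)"
  by (induction A rule: infinite_finite_induct) (simp_all add: act_add)

lemma act_add_right: "act p (\<lambda>z. h z + k z) z = act p h z + act p k z"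
  by (simp add: act_def word_act_linear distrib_left sum.distrib)

lemma act_mult_right: "act p (\<lambda>z. h z * a) z = act p h z * a"
  by (simp add: act_def word_act_linear sum_distrib_right mult.assoc)

lemma act_zero_right: "act p (\<lambda>z. 0) z = 0"
  by (simp add: act_def word_act_linear)

lemma act_mult: "act (p * q) h z = act p (act q h) z"
proof (induction p arbitrary: z rule: poly_mapping_single_add_induct)
  case (single u a)
  show ?case
  proof (induction q rule: poly_mapping_single_add_induct)
    case (single w b)
    have "act (Poly_Mapping.single w b) h = (\<lambda>z. b * word_act w h z)"
      by (simp add: act_single fun_eq_iff)
    then show ?case
      by (simp add: single_word_mult act_single word_act_append word_act_linear mult.assoc)
  next
    case (add p q)
    have "act (p + q) h = (\<lambda>z. act p h z + act q h z)"
      by (simp add: act_add fun_eq_iff)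
    then show ?case
      using add by (simp add: distrib_left act_add act_add_right)
  qed
next
  case (add p q)
  then show ?case by (simp add: distrib_right act_add)
qed

section \<open>The ideal acts by zero\<close>

lemma act_relator:
  assumes "p \<in> lpa_relators E"
  shows "act p h z = 0"
proof -
  obtain u y where z: "z = (u, y)" by (cases z)
  show ?thesis
    using assms
  proof cases
    case (ghost_edge f f')
    then show ?thesis
      \<comment> \<open>\<open>Ghost f\<close> encodes \<open>(f, y)\<close> into a point and
        \<open>Edge f'\<close> decodes that point, which returns the label \<open>f\<close>: the
        value survives for \<open>f' = f\<close> only.\<close>
      using dec_enc[of f y] by (auto simp: z gen_def single_word_mult act_diff act_single)
  next
    case (regular v)
    then have ne: "out_arcs E v \<noteq> {}" and fin: "finite (out_arcs E v)"
      by (auto simp: regular_vertices_def)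
    show ?thesis
    proof (cases "u = v")
      case True
      \<comment> \<open>The summand of \<open>f\<close> is the projection onto the part of X_v
        labelled by \<open>f\<close>, and \<open>(v, y)\<close> lies in exactly one part, that of
        \<open>fst (dec v y)\<close>.\<close>
      have "(\<Sum>f\<in>out_arcs E v. act (gen (Edge f) * gen (Ghost f)) h z)
          = (\<Sum>f\<in>out_arcs E v. if f = fst (dec v y) then h (v, y) else 0)"
        using enc_dec[OF ne, of y]
        by (intro sum.cong refl) (auto simp: z True gen_mult_gen act_single)
      also have "\<dots> = h (v, y)"
        using fin dec_arc[OF ne, of y] by simp
      finally show ?thesis
        using regular(1) by (simp add: act_diff act_sum gen_def act_single z True)
    next
      case False
      then have "(\<Sum>f\<in>out_arcs E v. act (gen (Edge f) * gen (Ghost f)) h z) = 0"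
        by (intro sum.neutral) (auto simp: z gen_mult_gen act_single)
      then show ?thesis
        using regular(1) False by (simp add: act_diff act_sum gen_def act_single z)
    qed
  qed (auto simp: z gen_def single_word_mult act_diff act_single)
qed

lemma act_ideal:
  assumes "p \<in> lpa_ideal E"
  shows "act p h z = 0"
  using assms
\<comment> \<open>\<open>h\<close> has to vary, since right multiplication by \<open>q\<close> turns
  \<open>h\<close> into \<open>act q h\<close>.\<close>
proof (induction arbitrary: h z rule: lpa_ideal.induct)
  case (scale_left p c)
  then have "act p h = (\<lambda>z. 0)" by auto
  then show ?case by (simp add: act_mult act_zero_right)
next
  case (mult_left p q)
  then have "act p h = (\<lambda>z. 0)" by auto
  then show ?case by (simp add: act_mult act_zero_right)
qed (simp_all add: act_relator act_add act_mult)

lemma regular_coefficient: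
  fixes x :: "'r::ring_1"
  assumes p_def: "p = Poly_Mapping.single [Vert v, Vert v] x"
    and ideal: "p - p * q * p \<in> lpa_ideal E"
  shows "\<exists>y. x = x * y * x"
proof -
  fix y0 :: 'y
  define z where "z = (v, y0)"
  define h where "h = (\<lambda>z'. if z' = z then 1 else 0 :: 'r)"
  \<comment> \<open>As \<open>h\<close> takes only the values 0 and 1, the coefficient
    \<open>x\<close> may be written on the right, and right linearity then takes it out of the
    action of \<open>q\<close>. What is left, \<open>act q h z\<close>, is the witness.\<close>
  have ph: "act p h = (\<lambda>z'. h z' * x)"
    by (auto simp: fun_eq_iff p_def act_single h_def z_def)
  have p: "act p k z = x * k z" for k
    by (simp add: p_def act_single z_def)
  have "act p h z = act (p * q * p) h z"
    using act_ideal[OF ideal, of h z] by (simp add: act_diff)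
  also have "\<dots> = x * (act q h z * x)"
    by (simp only: act_mult ph p act_mult_right mult.assoc)
  finally have "x * h z = x * (act q h z * x)"
    by (simp only: p)
  then show ?thesis
    by (auto simp: h_def mult.assoc)
qed

end

section \<open>Existence of branching systems\<close>

lemma ex_out_arcs_bij:
  fixes E :: "('v, 'e) pre_digraph"
  assumes "out_arcs E v \<noteq> {}"
  shows "\<exists>b. bij_betw b (out_arcs E v \<times> (UNIV :: 'e list set)) (UNIV :: 'e list set)"
proof -
  \<comment> \<open>Lists over the edge type are infinite in number and at least as many as the
    edges; a product of such a set with a non-empty set that is no larger has the same cardinality.
    So one fibre serves all vertices, whatever the size of the graph.\<close>
  have "(card_of (out_arcs E v), card_of (UNIV :: 'e list set)) \<in> ordLeq"
    unfolding card_of_ordLeq[symmetric] by (rule exI[of _ "\<lambda>f. [f]"]) (simp add: inj_on_def)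
  then have "(card_of (out_arcs E v \<times> (UNIV :: 'e list set)), card_of (UNIV :: 'e list set)) \<in> ordIso"
    using card_of_Times_infinite[OF infinite_UNIV_listI assms] by blast
  then show ?thesis
    unfolding card_of_ordIso[symmetric] .
qed

lemma (in wf_digraph) ex_branching_system:
  "\<exists>dec enc. branching_system G dec (enc :: 'a \<Rightarrow> 'b \<times> 'b list \<Rightarrow> 'b list)"
proof -
  let ?Y = "UNIV :: 'b list set"
  define enc where "enc v = (SOME b. bij_betw b (out_arcs G v \<times> ?Y) ?Y)" for v
  define dec where "dec v = inv_into (out_arcs G v \<times> ?Y) (enc v)" for v
  have bij: "bij_betw (enc v) (out_arcs G v \<times> ?Y) ?Y" if "out_arcs G v \<noteq> {}" for v
    unfolding enc_def using someI_ex[OF ex_out_arcs_bij[OF that]] .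
  show ?thesis
  proof (intro exI, unfold_locales)
    fix f y assume "f \<in> arcs G"
    then have "f \<in> out_arcs G (tail G f)" by simp
    then show "dec (tail G f) (enc (tail G f) (f, y)) = (f, y)"
      unfolding dec_def by (intro bij_betw_inv_into_left[OF bij]) auto
  next
    fix v and y :: "'b list" assume ne: "out_arcs G v \<noteq> {}"
    show "enc v (dec v y) = y"
      unfolding dec_def by (intro bij_betw_inv_into_right[OF bij[OF ne]]) simp
    have "dec v y \<in> out_arcs G v \<times> ?Y"
      using inv_into_into[of y "enc v" "out_arcs G v \<times> ?Y"] bij[OF ne]
      by (auto simp: dec_def bij_betw_def)
    then show "fst (dec v y) \<in> out_arcs G v" by auto
  qed
qed

section \<open>Descent of regularity to the coefficients\<close>

lemma (in wf_digraph) von_neumann_regular_if_graded: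
  assumes v: "v \<in> verts G"
    and reg: "graded_von_neumann_regular (lpa TYPE('r::ring_1) G) (lpa_mult G) (lpa_component G)"
  shows "von_neumann_regular TYPE('r)"
  unfolding von_neumann_regular_def
proof
  fix x :: 'r
  obtain dec and enc :: "'a \<Rightarrow> 'b \<times> 'b list \<Rightarrow> 'b list" where "branching_system G dec enc"
    using ex_branching_system by blast
  then interpret branching_system G dec enc .
  let ?e = "Poly_Mapping.single [Vert v] 1 :: ('a, 'b, 'r) free_alg"
  \<comment> \<open>This represents \<open>x v\<close> in degree 0. The letter is doubled because
    the component is spanned by products of a path and a star, here both trivial.\<close>
  let ?p = "Poly_Mapping.single [Vert v, Vert v] x :: ('a, 'b, 'r) free_alg"
  have e: "?e \<in> free_algebra G" and p: "?p \<in> free_algebra G"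
    using v by (auto intro!: single_in_free_algebra)
  have "lpa_mult G (lpa_path G v []) (lpa_path_star G v []) = lpa_class G (?e * ?e)"
    using lpa_class_mult[OF e e] by (simp add: lpa_path_def lpa_path_star_def)
  then have "lpa_scale G x (lpa_mult G (lpa_path G v []) (lpa_path_star G v []))
      = lpa_class G ?p"
    using lpa_class_scale[OF free_algebra_mult[OF e e], of x]
    by (simp add: single_word_mult scalar_mult_single)
  moreover have "lpa_scale G x (lpa_mult G (lpa_path G v []) (lpa_path_star G v []))
      \<in> lpa_component G 0"
    unfolding lpa_component_def using v
    by (intro lpa_span.scale) (force simp: awalk_Nil_iff)
  ultimately obtain s where "s \<in> lpa TYPE('r) G"
    and s: "lpa_class G ?p = lpa_mult G (lpa_mult G (lpa_class G ?p) s) (lpa_class G ?p)"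
    using reg by (metis graded_von_neumann_regular_def)
  then obtain q where q: "q \<in> free_algebra G" "s = lpa_class G q"
    by (auto simp: lpa_def lpa_class_def elim: quotientE)
  have "lpa_class G ?p = lpa_class G (?p * q * ?p)"
    using s q p by (simp add: lpa_class_mult free_algebra_mult)
  then have "?p - ?p * q * ?p \<in> lpa_ideal G"
    using p q by (simp add: lpa_class_eq_iff free_algebra_mult)
  then show "\<exists>y. x = x * y * x"
    by (rule regular_coefficient[OF refl])
qed

section \<open>Reduction of words\<close>

text \<open>Quantifying over all coefficients lets words be rewritten under any coefficient. Words
  do not mention \<open>'r\<close>, hence the type argument.\<close>

definition word_eq ::
    "'r::ring_1 itself \<Rightarrow> ('v, 'e) pre_digraph \<Rightarrow> ('v, 'e) generator list
      \<Rightarrow> ('v, 'e) generator list \<Rightarrow> bool" where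
  "word_eq _ E w w' \<longleftrightarrow>
     (\<forall>c::'r. Poly_Mapping.single w c - Poly_Mapping.single w' c \<in> lpa_ideal E)"

definition word_null ::
    "'r::ring_1 itself \<Rightarrow> ('v, 'e) pre_digraph \<Rightarrow> ('v, 'e) generator list \<Rightarrow> bool" where
  "word_null _ E w \<longleftrightarrow> (\<forall>c::'r. Poly_Mapping.single w c \<in> lpa_ideal E)"

locale leavitt_algebra = wf_digraph E for E :: "('v, 'e) pre_digraph" +
  fixes R :: "'r::ring_1 itself"
begin

abbreviation word_eq_infix (infix "\<approx>" 50) where
  "w \<approx> w' \<equiv> word_eq R E w w'"

abbreviation vanishes where
  "vanishes w \<equiv> word_null R E w"

section \<open>Congruence of words modulo the ideal\<close>

lemma word_eq_sym: "w \<approx> w' \<Longrightarrow> w' \<approx> w"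
  unfolding word_eq_def using lpa_ideal_uminus by fastforce

lemma word_eq_trans [trans]: "w \<approx> w' \<Longrightarrow> w' \<approx> w'' \<Longrightarrow> w \<approx> w''"
  unfolding word_eq_def
proof
  fix c :: 'r
  assume "\<forall>c::'r. Poly_Mapping.single w c - Poly_Mapping.single w' c \<in> lpa_ideal E"
    and "\<forall>c::'r. Poly_Mapping.single w' c - Poly_Mapping.single w'' c \<in> lpa_ideal E"
  then have "(Poly_Mapping.single w c - Poly_Mapping.single w' c)
      + (Poly_Mapping.single w' c - Poly_Mapping.single w'' c) \<in> lpa_ideal E"
    by (intro lpa_ideal.add) auto
  then show "Poly_Mapping.single w c - Poly_Mapping.single w'' c \<in> lpa_ideal E"
    by simp
qed

lemma word_null_cong: "w \<approx> w' \<Longrightarrow> vanishes w' \<Longrightarrow> vanishes w"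
  unfolding word_eq_def word_null_def
proof
  fix c :: 'r
  assume "\<forall>c::'r. Poly_Mapping.single w c - Poly_Mapping.single w' c \<in> lpa_ideal E"
    and "\<forall>c::'r. Poly_Mapping.single w' c \<in> lpa_ideal E"
  then have "(Poly_Mapping.single w c - Poly_Mapping.single w' c)
      + Poly_Mapping.single w' c \<in> lpa_ideal E"
    by (intro lpa_ideal.add) auto
  then show "Poly_Mapping.single w c \<in> lpa_ideal E"
    by simp
qed

text \<open>The empty word does not belong to the non-unital algebra, so the closure rules of the
  ideal do not cover it; it acts as 1 and is treated apart.\<close>

lemma lpa_ideal_mult_words:
  fixes p :: "('v, 'e, 'r) free_alg"
  assumes "p \<in> lpa_ideal E" "set x \<subseteq> generators E" "set y \<subseteq> generators E"
  shows "Poly_Mapping.single x 1 * p * Poly_Mapping.single y 1 \<in> lpa_ideal E"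
proof -
  have one: "Poly_Mapping.single [] (1::'r) = 1"
    by (metis single_one zero_list_def)
  have "Poly_Mapping.single x 1 * p \<in> lpa_ideal E"
    using assms lpa_ideal.mult_left[OF _ single_in_free_algebra]
    by (cases "x = []") (simp_all add: one)
  then show ?thesis
    using assms lpa_ideal.mult_right[OF _ single_in_free_algebra]
    by (cases "y = []") (simp_all add: one)
qed

lemma word_eq_context:
  assumes "w \<approx> w'" "set x \<subseteq> generators E" "set y \<subseteq> generators E"
  shows "x @ w @ y \<approx> x @ w' @ y"
  unfolding word_eq_def
proof
  fix c :: 'r
  have "Poly_Mapping.single x 1 * (Poly_Mapping.single w c - Poly_Mapping.single w' c)
      * Poly_Mapping.single y 1 \<in> lpa_ideal E"
    using assms by (intro lpa_ideal_mult_words) (auto simp: word_eq_def)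
  then show "Poly_Mapping.single (x @ w @ y) c - Poly_Mapping.single (x @ w' @ y) c \<in> lpa_ideal E"
    by (simp add: right_diff_distrib left_diff_distrib single_word_mult)
qed

lemma word_null_context:
  assumes "vanishes w" "set x \<subseteq> generators E" "set y \<subseteq> generators E"
  shows "vanishes (x @ w @ y)"
  unfolding word_null_def
proof
  fix c :: 'r
  have "Poly_Mapping.single x 1 * Poly_Mapping.single w c * Poly_Mapping.single y 1 \<in> lpa_ideal E"
    using assms by (intro lpa_ideal_mult_words) (auto simp: word_null_def)
  then show "Poly_Mapping.single (x @ w @ y) c \<in> lpa_ideal E"
    by (simp add: single_word_mult)
qed

section \<open>Defining relations as congruences of words\<close>

lemma word_eq_of_relator:
  assumes "Poly_Mapping.single w 1 - Poly_Mapping.single w' 1 \<in> (lpa_relators E :: ('v, 'e, 'r) free_alg set)"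
  shows "w \<approx> w'"
  unfolding word_eq_def
proof
  fix c :: 'r
  show "Poly_Mapping.single w c - Poly_Mapping.single w' c \<in> lpa_ideal E"
    using lpa_ideal.scale_left[OF lpa_ideal.relator[OF assms], of c]
    by (simp add: right_diff_distrib scalar_mult_single)
qed

lemma word_null_of_relator:
  assumes "Poly_Mapping.single w 1 \<in> (lpa_relators E :: ('v, 'e, 'r) free_alg set)"
  shows "vanishes w"
  unfolding word_null_def
proof
  fix c :: 'r
  show "Poly_Mapping.single w c \<in> lpa_ideal E"
    using lpa_ideal.scale_left[OF lpa_ideal.relator[OF assms], of c]
    by (simp add: scalar_mult_single)
qed

lemma word_eq_relations:
  "v \<in> verts E \<Longrightarrow> [Vert v, Vert v] \<approx> [Vert v]"
  "f \<in> arcs E \<Longrightarrow> [Vert (tail E f), Edge f] \<approx> [Edge f]"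
  "f \<in> arcs E \<Longrightarrow> [Edge f, Vert (head E f)] \<approx> [Edge f]"
  "f \<in> arcs E \<Longrightarrow> [Vert (head E f), Ghost f] \<approx> [Ghost f]"
  "f \<in> arcs E \<Longrightarrow> [Ghost f, Vert (tail E f)] \<approx> [Ghost f]"
  "f \<in> arcs E \<Longrightarrow> [Ghost f, Edge f] \<approx> [Vert (head E f)]"
  using lpa_relators.vert_vert[of v E v, where 'r='r] lpa_relators.tail_edge[of f E, where 'r='r]
    lpa_relators.edge_head[of f E, where 'r='r] lpa_relators.head_ghost[of f E, where 'r='r]
    lpa_relators.ghost_tail[of f E, where 'r='r] lpa_relators.ghost_edge[of f E f, where 'r='r]
  by (simp_all add: gen_def single_word_mult word_eq_of_relator)

lemma word_null_relations:
  "v \<in> verts E \<Longrightarrow> v' \<in> verts E \<Longrightarrow> v \<noteq> v' \<Longrightarrow> vanishes [Vert v, Vert v']"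
  "f \<in> arcs E \<Longrightarrow> f' \<in> arcs E \<Longrightarrow> f \<noteq> f' \<Longrightarrow> vanishes [Ghost f, Edge f']"
  using lpa_relators.vert_vert[of v E v', where 'r='r] lpa_relators.ghost_edge[of f E f', where 'r='r]
  by (simp_all add: gen_def single_word_mult word_null_of_relator)

text \<open>The leading vertex keeps the word non-empty and lets trivial paths be handled without a
  case distinction; \<open>star_word\<close> ends with its vertex for the same reason.\<close>

definition path_word :: "'v \<Rightarrow> 'e list \<Rightarrow> ('v, 'e) generator list" where
  "path_word u \<alpha> = Vert u # map Edge \<alpha>"

definition star_word :: "'v \<Rightarrow> 'e list \<Rightarrow> ('v, 'e) generator list" where
  "star_word u \<beta> = map Ghost (rev \<beta>) @ [Vert u]"

lemma image_subset_generators [simp]: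
  "Edge ` A \<subseteq> generators E \<longleftrightarrow> A \<subseteq> arcs E"
  "Ghost ` A \<subseteq> generators E \<longleftrightarrow> A \<subseteq> arcs E"
  by auto

lemma set_path_word [simp]: "awalk u \<alpha> w \<Longrightarrow> set (path_word u \<alpha>) \<subseteq> generators E"
  and set_star_word [simp]: "awalk u \<alpha> w \<Longrightarrow> set (star_word u \<alpha>) \<subseteq> generators E"
  by (auto simp: path_word_def star_word_def awalk_def)

lemma awalk_arcs: "awalk u \<alpha> w \<Longrightarrow> set \<alpha> \<subseteq> arcs E"
  by (simp add: awalk_def)

section \<open>Absorption of end vertices and concatenation\<close>

lemma path_word_Cons:
  assumes "awalk u (f # \<alpha>) w"
  shows "path_word u (f # \<alpha>) \<approx> [Vert u, Edge f] @ path_word (head E f) \<alpha>"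
proof -
  have f: "f \<in> arcs E" "set \<alpha> \<subseteq> arcs E" "u \<in> verts E"
    using assms by (auto simp: awalk_def)
  have "[Vert u] @ [Edge f, Vert (head E f)] @ map Edge \<alpha> \<approx> [Vert u] @ [Edge f] @ map Edge \<alpha>"
    using f by (intro word_eq_context word_eq_relations) auto
  then show ?thesis
    by (simp add: path_word_def word_eq_sym)
qed

lemma star_word_Cons:
  assumes "awalk u (f # \<alpha>) w"
  shows "star_word u (f # \<alpha>) \<approx> star_word (head E f) \<alpha> @ [Ghost f, Vert u]"
proof -
  have f: "f \<in> arcs E" "set \<alpha> \<subseteq> arcs E" "u \<in> verts E"
    using assms by (auto simp: awalk_def)
  have "map Ghost (rev \<alpha>) @ [Vert (head E f), Ghost f] @ [Vert u]
      \<approx> map Ghost (rev \<alpha>) @ [Ghost f] @ [Vert u]"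
    using f by (intro word_eq_context word_eq_relations) auto
  then show ?thesis
    by (simp add: star_word_def word_eq_sym)
qed

lemma path_word_end:
  "awalk u \<alpha> w \<Longrightarrow> path_word u \<alpha> @ [Vert w] \<approx> path_word u \<alpha>"
proof (induction \<alpha> arbitrary: u)
  case Nil
  then show ?case by (auto simp: path_word_def awalk_Nil_iff word_eq_relations)
next
  case (Cons f \<alpha>)
  then have \<alpha>: "awalk (head E f) \<alpha> w" and g: "set [Vert u, Edge f] \<subseteq> generators E"
      and w: "set [Vert w] \<subseteq> generators E"
    by (auto simp: awalk_Cons_iff)
  have "path_word u (f # \<alpha>) @ [Vert w]
      \<approx> [Vert u, Edge f] @ (path_word (head E f) \<alpha> @ [Vert w]) @ []"
    using word_eq_context[OF path_word_Cons[OF Cons.prems], of "[]" "[Vert w]"] w by simp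
  also have "\<dots> \<approx> [Vert u, Edge f] @ path_word (head E f) \<alpha> @ []"
    by (rule word_eq_context[OF Cons.IH[OF \<alpha>] g]) simp
  also have "\<dots> \<approx> path_word u (f # \<alpha>)"
    using word_eq_sym[OF path_word_Cons[OF Cons.prems]] by simp
  finally show ?case .
qed

lemma star_word_start:
  "awalk u \<beta> w \<Longrightarrow> [Vert w] @ star_word u \<beta> \<approx> star_word u \<beta>"
proof (induction \<beta> arbitrary: u)
  case Nil
  then show ?case by (auto simp: star_word_def awalk_Nil_iff word_eq_relations)
next
  case (Cons f \<beta>)
  then have \<beta>: "awalk (head E f) \<beta> w" and g: "set [Ghost f, Vert u] \<subseteq> generators E"
      and w: "set [Vert w] \<subseteq> generators E"
    by (auto simp: awalk_Cons_iff)
  have "[Vert w] @ star_word u (f # \<beta>)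
      \<approx> [] @ ([Vert w] @ star_word (head E f) \<beta>) @ [Ghost f, Vert u]"
    using word_eq_context[OF star_word_Cons[OF Cons.prems], of "[Vert w]" "[]"] w by simp
  also have "\<dots> \<approx> [] @ star_word (head E f) \<beta> @ [Ghost f, Vert u]"
    by (rule word_eq_context[OF Cons.IH[OF \<beta>] _ g]) simp
  also have "\<dots> \<approx> star_word u (f # \<beta>)"
    using word_eq_sym[OF star_word_Cons[OF Cons.prems]] by simp
  finally show ?case .
qed

lemma path_word_append:
  assumes "awalk u \<alpha> w" "awalk w \<rho> w'"
  shows "path_word u \<alpha> @ path_word w \<rho> \<approx> path_word u (\<alpha> @ \<rho>)"
  using word_eq_context[OF path_word_end[OF assms(1)], of "[]" "map Edge \<rho>"] awalk_arcs[OF assms(2)]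
  by (simp add: path_word_def)

lemma star_word_append:
  assumes "awalk u \<beta> w" "awalk w \<rho> w'"
  shows "star_word w \<rho> @ star_word u \<beta> \<approx> star_word u (\<beta> @ \<rho>)"
  using word_eq_context[OF star_word_start[OF assms(1)], of "map Ghost (rev \<rho>)" "[]"]
    awalk_arcs[OF assms(2)]
  by (simp add: star_word_def)

text \<open>Ghost edges cancel against edges from the common source onwards. A mismatch gives 0;
  otherwise the shorter path is used up and the rest \<tau> of the longer one remains.\<close>

lemma star_word_path_word:
  assumes "awalk u \<beta> w" "awalk u' \<beta>' w'"
  shows "vanishes (star_word u \<beta> @ path_word u' \<beta>')
    \<or> (\<exists>\<tau>. u = u' \<and> \<beta> = \<beta>' @ \<tau> \<and> awalk w' \<tau> w
         \<and> star_word u \<beta> @ path_word u' \<beta>' \<approx> star_word w' \<tau>)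
    \<or> (\<exists>\<tau>. u = u' \<and> \<beta>' = \<beta> @ \<tau> \<and> awalk w \<tau> w'
         \<and> star_word u \<beta> @ path_word u' \<beta>' \<approx> path_word w \<tau>)"
  using assms
proof (induction \<beta> arbitrary: u u' \<beta>')
  case Nil
  then have u: "u \<in> verts E" "u' \<in> verts E" "u = w" "set \<beta>' \<subseteq> arcs E"
    by (auto simp: awalk_def)
  show ?case
  proof (cases "u = u'")
    case True
    have "[] @ [Vert u, Vert u] @ map Edge \<beta>' \<approx> [] @ [Vert u] @ map Edge \<beta>'"
      using u by (intro word_eq_context word_eq_relations) auto
    then show ?thesis
      using True u Nil by (auto simp: star_word_def path_word_def)
  next
    case False
    have "vanishes ([] @ [Vert u, Vert u'] @ map Edge \<beta>')"
      using u False by (intro word_null_context word_null_relations) auto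
    then show ?thesis
      by (simp add: star_word_def path_word_def)
  qed
next
  case (Cons f \<beta>)
  then have \<beta>: "awalk (head E f) \<beta> w" and f: "f \<in> arcs E" "u = tail E f" "u \<in> verts E"
      and \<beta>arcs: "set \<beta> \<subseteq> arcs E" and \<beta>': "u' \<in> verts E" "set \<beta>' \<subseteq> arcs E"
    by (auto simp: awalk_Cons_iff)
  show ?case
  proof (cases "u = u'")
    case False
    have "vanishes ((map Ghost (rev (f # \<beta>))) @ [Vert u, Vert u'] @ map Edge \<beta>')"
      using f \<beta>arcs \<beta>' False by (intro word_null_context word_null_relations) auto
    then show ?thesis
      by (simp add: star_word_def path_word_def)
  next
    case True
    \<comment> \<open>The two source vertices merge into one, which \<open>Ghost f\<close> absorbs,
      so that \<open>Ghost f\<close> meets the first edge of \<beta>' directly.\<close>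
    have VV: "star_word u (f # \<beta>) @ path_word u' \<beta>' \<approx> map Ghost (rev \<beta>) @ [Ghost f] @ map Edge \<beta>'"
    proof -
      have "star_word u (f # \<beta>) @ path_word u' \<beta>'
          = (map Ghost (rev (f # \<beta>))) @ [Vert u, Vert u] @ map Edge \<beta>'"
        using True by (simp add: star_word_def path_word_def)
      also have "\<dots> \<approx> (map Ghost (rev (f # \<beta>))) @ [Vert u] @ map Edge \<beta>'"
        using f \<beta>arcs \<beta>' by (intro word_eq_context word_eq_relations) auto
      also have "\<dots> = map Ghost (rev \<beta>) @ [Ghost f, Vert u] @ map Edge \<beta>'"
        by simp
      also have "\<dots> \<approx> map Ghost (rev \<beta>) @ [Ghost f] @ map Edge \<beta>'"
        unfolding f(2) using f \<beta>arcs \<beta>' by (intro word_eq_context word_eq_relations) auto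
      finally show ?thesis .
    qed
    show ?thesis
    proof (cases \<beta>')
      case Nil
      have "map Ghost (rev \<beta>) @ [Ghost f, Vert u] @ [] \<approx> map Ghost (rev \<beta>) @ [Ghost f] @ []"
        unfolding f(2) using f \<beta>arcs by (intro word_eq_context word_eq_relations) auto
      then have "star_word u (f # \<beta>) \<approx> map Ghost (rev \<beta>) @ [Ghost f] @ map Edge \<beta>'"
        by (simp add: Nil star_word_def)
      from word_eq_trans[OF VV word_eq_sym[OF this]]
      have "star_word u (f # \<beta>) @ path_word u' \<beta>' \<approx> star_word u (f # \<beta>)" .
      then show ?thesis
        using True Nil Cons.prems by (auto simp: awalk_Nil_iff)
    next
      case (Cons g \<gamma>)
      then have g: "g \<in> arcs E" "awalk (head E g) \<gamma> w'" "set \<gamma> \<subseteq> arcs E"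
        using Cons.prems(2) \<beta>' by (auto simp: awalk_Cons_iff)
      show ?thesis
      proof (cases "f = g")
        case False
        have "vanishes (map Ghost (rev \<beta>) @ [Ghost f, Edge g] @ map Edge \<gamma>)"
          using f \<beta>arcs g False by (intro word_null_context word_null_relations) auto
        then show ?thesis
          using word_null_cong[OF VV] Cons by simp
      next
        case fg: True
        have h: "head E f \<in> verts E" using f by simp
        note VV
        also have "map Ghost (rev \<beta>) @ [Ghost f] @ map Edge \<beta>'
            = map Ghost (rev \<beta>) @ [Ghost f, Edge f] @ map Edge \<gamma>"
          by (simp add: Cons fg)
        also have "\<dots> \<approx> map Ghost (rev \<beta>) @ [Vert (head E f)] @ map Edge \<gamma>"
          using f \<beta>arcs g by (intro word_eq_context word_eq_relations) auto
        \<comment> \<open>The vertex left by the cancellation is doubled, so that both halves regain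
          the form required by the induction hypothesis.\<close>
        also have "\<dots> \<approx> map Ghost (rev \<beta>) @ [Vert (head E f), Vert (head E f)] @ map Edge \<gamma>"
          using f \<beta>arcs g h by (intro word_eq_context word_eq_sym[OF word_eq_relations(1)]) auto
        also have "\<dots> = star_word (head E f) \<beta> @ path_word (head E f) \<gamma>"
          by (simp add: star_word_def path_word_def)
        finally have *: "star_word u (f # \<beta>) @ path_word u' \<beta>'
            \<approx> star_word (head E f) \<beta> @ path_word (head E f) \<gamma>" .
        have "awalk (head E f) \<gamma> w'" using g fg by simp
        from Cons.IH[OF \<beta> this] show ?thesis
          using word_null_cong[OF *] word_eq_trans[OF *] True fg \<open>\<beta>' = g # \<gamma>\<close> by auto
      qed
    qed
  qed
qed


section \<open>Spans of monomials\<close>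

fun mon :: "'v \<times> 'e list \<times> 'v \<times> 'e list \<Rightarrow> ('v, 'e) generator list" where
  "mon (u, \<alpha>, u', \<beta>) = path_word u \<alpha> @ star_word u' \<beta>"

text \<open>The involution on indices: \<open>mon (dual j)\<close> is
  \<open>e\<^sub>j\<^sup>*\<close> in the notation of the overview.\<close>

fun dual :: "'v \<times> 'e list \<times> 'v \<times> 'e list \<Rightarrow> 'v \<times> 'e list \<times> 'v \<times> 'e list" where
  "dual (u, \<alpha>, u', \<beta>) = (u', \<beta>, u, \<alpha>)"

text \<open>Only pairs with a common range are kept, as the others vanish by
  \<open>path_word_star_word_null\<close>. Sources are recorded because the empty edge list does not
  determine its vertex.\<close>

definition monomials :: "int \<Rightarrow> ('v \<times> 'e list \<times> 'v \<times> 'e list) set" where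
  "monomials i = {(u, \<alpha>, u', \<beta>). (\<exists>w. awalk u \<alpha> w \<and> awalk u' \<beta> w)
     \<and> int (length \<alpha>) - int (length \<beta>) = i}"

lemma monomialsE:
  assumes "j \<in> monomials i"
  obtains u \<alpha> u' \<beta> w where "j = (u, \<alpha>, u', \<beta>)" "awalk u \<alpha> w" "awalk u' \<beta> w"
    "int (length \<alpha>) - int (length \<beta>) = i"
  using assms by (auto simp: monomials_def)

text \<open>Containing the ideal, this is a span modulo the ideal, but on representatives.
  Expansions need not be unique: relation (v) can make monomials dependent.\<close>

inductive_set mon_span ::
    "('v \<times> 'e list \<times> 'v \<times> 'e list) set \<Rightarrow> ('v, 'e, 'r) free_alg set"
  for S :: "('v \<times> 'e list \<times> 'v \<times> 'e list) set" where
  ideal: "p \<in> lpa_ideal E \<Longrightarrow> p \<in> mon_span S"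
| mon: "j \<in> S \<Longrightarrow> Poly_Mapping.single (mon j) c \<in> mon_span S"
| add: "p \<in> mon_span S \<Longrightarrow> q \<in> mon_span S \<Longrightarrow> p + q \<in> mon_span S"

lemma mon_span_uminus: "p \<in> mon_span S \<Longrightarrow> - p \<in> mon_span S"
proof (induction rule: mon_span.induct)
  case (mon j c)
  then show ?case using mon_span.mon[of j S "- c"] by (simp add: single_uminus)
next
  case (add p q)
  then show ?case using mon_span.add[of "- p" S "- q"] by simp
qed (simp add: mon_span.ideal lpa_ideal_uminus)

lemma mon_span_diff: "p \<in> mon_span S \<Longrightarrow> q \<in> mon_span S \<Longrightarrow> p - q \<in> mon_span S"
  using mon_span.add[OF _ mon_span_uminus, of p S q] by simp

lemma mon_span_mono: "p \<in> mon_span S \<Longrightarrow> S \<subseteq> T \<Longrightarrow> p \<in> mon_span T"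
  by (induction rule: mon_span.induct) (auto intro: mon_span.intros)

lemma mon_span_empty: "p \<in> mon_span {} \<Longrightarrow> p \<in> lpa_ideal E"
  by (induction rule: mon_span.induct) (auto intro: lpa_ideal.add)

lemma mon_span_finite: "p \<in> mon_span S \<Longrightarrow> \<exists>F\<subseteq>S. finite F \<and> p \<in> mon_span F"
proof (induction rule: mon_span.induct)
  case (ideal p)
  then show ?case by (intro exI[of _ "{}"]) (auto intro: mon_span.ideal)
next
  case (mon j c)
  then show ?case by (intro exI[of _ "{j}"]) (auto intro: mon_span.mon)
next
  case (add p q)
  then obtain F G where "F \<subseteq> S" "finite F" "p \<in> mon_span F" "G \<subseteq> S" "finite G" "q \<in> mon_span G"
    by blast
  then show ?case
    by (intro exI[of _ "F \<union> G"]) (auto intro: mon_span.add mon_span_mono)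
qed

lemma mon_span_insert:
  "p \<in> mon_span (insert j S) \<Longrightarrow> \<exists>c. \<exists>q\<in>mon_span S. p = Poly_Mapping.single (mon j) c + q"
proof (induction rule: mon_span.induct)
  case (ideal p)
  then show ?case by (intro exI[of _ 0] bexI[of _ p]) (auto intro: mon_span.ideal)
next
  case (mon k c)
  show ?case
  proof (cases "k = j")
    case True
    then show ?thesis
      by (intro exI[of _ c] bexI[of _ 0]) (auto intro: mon_span.ideal lpa_ideal.zero)
  next
    case False
    with mon show ?thesis
      by (intro exI[of _ 0] bexI[of _ "Poly_Mapping.single (mon k) c"]) (auto intro: mon_span.mon)
  qed
next
  case (add p q)
  then obtain c p' d q' where "p' \<in> mon_span S" "p = Poly_Mapping.single (mon j) c + p'"
      "q' \<in> mon_span S" "q = Poly_Mapping.single (mon j) d + q'"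
    by blast
  then show ?case
    by (intro exI[of _ "c + d"] bexI[of _ "p' + q'"])
      (auto intro: mon_span.add simp: single_add algebra_simps)
qed

section \<open>Membership in the non-unital algebra\<close>

lemma lpa_relators_subset_free_algebra:
  "p \<in> lpa_relators E \<Longrightarrow> p \<in> free_algebra E"
  by (induction rule: lpa_relators.induct)
    (auto simp: regular_vertices_def
      intro!: free_algebra_diff free_algebra_mult gen_in_free_algebra free_algebra_zero free_algebra_sum)

lemma lpa_ideal_subset_free_algebra:
  "p \<in> lpa_ideal E \<Longrightarrow> p \<in> free_algebra E"
  by (induction rule: lpa_ideal.induct)
    (auto intro: lpa_relators_subset_free_algebra free_algebra_zero free_algebra_add
      free_algebra_scale free_algebra_scale_right free_algebra_mult)

lemma single_mon_in_free_algebra: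
  assumes "j \<in> monomials i"
  shows "Poly_Mapping.single (mon j) c \<in> free_algebra E"
  using assms
proof (rule monomialsE)
  fix u \<alpha> u' \<beta> w
  assume "j = (u, \<alpha>, u', \<beta>)" "awalk u \<alpha> w" "awalk u' \<beta> w"
  then show ?thesis
    using set_path_word set_star_word
    by (intro single_in_free_algebra) (auto simp: path_word_def star_word_def)
qed

lemma dual_monomials: "j \<in> monomials i \<Longrightarrow> dual j \<in> monomials (- i)"
  by (auto simp: monomials_def)

lemma mon_span_subset_free_algebra:
  assumes "p \<in> mon_span S" "S \<subseteq> monomials i"
  shows "p \<in> free_algebra E"
  using assms
  by (induction rule: mon_span.induct)
    (auto intro: lpa_ideal_subset_free_algebra single_mon_in_free_algebra free_algebra_add)

lemma mon_span_word_eq: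
  assumes "w \<approx> mon j" "j \<in> S"
  shows "Poly_Mapping.single w c \<in> mon_span S"
proof -
  have "(Poly_Mapping.single w c - Poly_Mapping.single (mon j) c)
      + Poly_Mapping.single (mon j) c \<in> mon_span S"
    using assms by (intro mon_span.add mon_span.mon mon_span.ideal) (auto simp: word_eq_def)
  then show ?thesis by simp
qed

text \<open>By bilinearity only triples of monomials need checking; if an outer factor is in the
  ideal, so is the product, the other factors being elements of the algebra.\<close>

lemma mon_span_product:
  assumes "q \<in> mon_span A" "q' \<in> mon_span B" "A \<subseteq> monomials i" "B \<subseteq> monomials i"
    and j: "j \<in> monomials i"
    and AB: "\<And>l m c. l \<in> A \<Longrightarrow> m \<in> B
      \<Longrightarrow> Poly_Mapping.single (mon l @ mon (dual j) @ mon m) c \<in> mon_span S"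
  shows "q * Poly_Mapping.single (mon (dual j)) d * q' \<in> mon_span S"
proof -
  note free = single_mon_in_free_algebra[OF dual_monomials[OF j], of d]
  have q': "q' \<in> free_algebra E"
    using assms by (rule_tac mon_span_subset_free_algebra)
  show ?thesis
    using assms(1)
  proof (induction rule: mon_span.induct)
    case (ideal p)
    then show ?case
      by (intro mon_span.ideal lpa_ideal.mult_right free q')
  next
    case (mon l c)
    from assms(2) show ?case
    proof (induction rule: mon_span.induct)
      case (ideal p)
      have "l \<in> monomials i" using mon assms(3) by blast
      then show ?case
        using ideal
        by (intro mon_span.ideal lpa_ideal.mult_left free_algebra_mult free single_mon_in_free_algebra)
    next
      case (mon m c')
      then show ?case
        using AB[OF \<open>l \<in> A\<close>] by (simp add: single_word_mult)
    next
      case (add p q)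
      then show ?case by (auto simp: distrib_left intro: mon_span.add)
    qed
  next
    case (add p q)
    then show ?case by (auto simp: distrib_right intro: mon_span.add)
  qed
qed


section \<open>Products of monomials\<close>

text \<open>The case of \<open>star_word_path_word\<close> in which the other path is the longer one
  survives at equal lengths only; there \<tau> is empty, and \<open>star_word\<close> and
  \<open>path_word\<close> are the same single vertex.\<close>

lemma star_word_path_word_long:
  assumes "awalk u \<beta> w" "awalk u' \<beta>' w'" "length \<beta>' \<le> length \<beta>"
  shows "vanishes (star_word u \<beta> @ path_word u' \<beta>')
    \<or> (\<exists>\<tau>. u = u' \<and> \<beta> = \<beta>' @ \<tau> \<and> awalk w' \<tau> w
         \<and> star_word u \<beta> @ path_word u' \<beta>' \<approx> star_word w' \<tau>)"
  using star_word_path_word[OF assms(1,2)]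
proof (elim disjE exE)
  fix \<tau>
  assume *: "u = u' \<and> \<beta>' = \<beta> @ \<tau> \<and> awalk w \<tau> w'
    \<and> star_word u \<beta> @ path_word u' \<beta>' \<approx> path_word w \<tau>"
  with assms(3) have "\<tau> = []" by simp
  with * have "u = u' \<and> \<beta> = \<beta>' @ [] \<and> awalk w' [] w
      \<and> star_word u \<beta> @ path_word u' \<beta>' \<approx> star_word w' []"
    by (auto simp: awalk_Nil_iff path_word_def star_word_def)
  then show ?thesis by blast
qed blast+

lemma star_word_long_path_word:
  assumes "awalk u \<beta> w" "awalk u' \<beta>' w'" "length \<beta> \<le> length \<beta>'"
  shows "vanishes (star_word u \<beta> @ path_word u' \<beta>')
    \<or> (\<exists>\<tau>. u = u' \<and> \<beta>' = \<beta> @ \<tau> \<and> awalk w \<tau> w'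
         \<and> star_word u \<beta> @ path_word u' \<beta>' \<approx> path_word w \<tau>)"
  using star_word_path_word[OF assms(1,2)]
proof (elim disjE exE)
  fix \<tau>
  assume *: "u = u' \<and> \<beta> = \<beta>' @ \<tau> \<and> awalk w' \<tau> w
    \<and> star_word u \<beta> @ path_word u' \<beta>' \<approx> star_word w' \<tau>"
  with assms(3) have "\<tau> = []" by simp
  with * have "u = u' \<and> \<beta>' = \<beta> @ [] \<and> awalk w [] w'
      \<and> star_word u \<beta> @ path_word u' \<beta>' \<approx> path_word w []"
    by (auto simp: awalk_Nil_iff path_word_def star_word_def)
  then show ?thesis by blast
qed blast+

text \<open>The cancellation is carried out again, as \<open>star_word_path_word\<close> alone does
  not exclude its vanishing case.\<close>

lemma star_word_path_word_same:
  "awalk u \<beta> w \<Longrightarrow> star_word u \<beta> @ path_word u \<beta> \<approx> [Vert w]"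
proof (induction \<beta> arbitrary: u)
  case Nil
  then show ?case
    by (auto simp: awalk_Nil_iff star_word_def path_word_def word_eq_relations)
next
  case (Cons f \<beta>)
  then have \<beta>: "awalk (head E f) \<beta> w" and f: "f \<in> arcs E" "u = tail E f" "tail E f \<in> verts E"
    and g: "set (map Ghost (rev \<beta>) :: ('v, 'e) generator list) \<subseteq> generators E"
      "set (map Edge \<beta> :: ('v, 'e) generator list) \<subseteq> generators E"
    by (auto simp: awalk_Cons_iff dest: awalk_arcs)
  have "star_word u (f # \<beta>) @ path_word u (f # \<beta>)
      = (map Ghost (rev \<beta>) @ [Ghost f]) @ [Vert (tail E f), Vert (tail E f)] @ (Edge f # map Edge \<beta>)"
    by (simp add: star_word_def path_word_def f)
  also have "\<dots> \<approx> (map Ghost (rev \<beta>) @ [Ghost f]) @ [Vert (tail E f)] @ (Edge f # map Edge \<beta>)"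
    using f g by (intro word_eq_context word_eq_relations(1)) auto
  also have "\<dots> = map Ghost (rev \<beta>) @ [Ghost f, Vert (tail E f)] @ (Edge f # map Edge \<beta>)"
    by simp
  also have "\<dots> \<approx> map Ghost (rev \<beta>) @ [Ghost f] @ (Edge f # map Edge \<beta>)"
    using f g by (intro word_eq_context word_eq_relations(5)) auto
  also have "\<dots> = map Ghost (rev \<beta>) @ [Ghost f, Edge f] @ map Edge \<beta>"
    by simp
  also have "\<dots> \<approx> map Ghost (rev \<beta>) @ [Vert (head E f)] @ map Edge \<beta>"
    using f g by (intro word_eq_context word_eq_relations(6)) auto
  also have "\<dots> \<approx> map Ghost (rev \<beta>) @ [Vert (head E f), Vert (head E f)] @ map Edge \<beta>"
    using f g by (intro word_eq_context word_eq_sym[OF word_eq_relations(1)]) auto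
  also have "\<dots> = star_word (head E f) \<beta> @ path_word (head E f) \<beta>"
    by (simp add: star_word_def path_word_def)
  also have "\<dots> \<approx> [Vert w]"
    by (rule Cons.IH[OF \<beta>])
  finally show ?case .
qed

text \<open>Monomials are partial isometries: by \<open>\<beta>\<^sup>*\<beta> = r(\<beta>)\<close>
  and \<open>\<alpha>\<^sup>*\<alpha> = r(\<alpha>)\<close> the inner factors collapse to the common
  range \<open>w\<close>.\<close>

lemma mon_dual_mon:
  assumes "j \<in> monomials i"
  shows "mon j @ mon (dual j) @ mon j \<approx> mon j"
  using assms
proof (rule monomialsE)
  fix u \<alpha> u' \<beta> w
  assume j: "j = (u, \<alpha>, u', \<beta>)" and w: "awalk u \<alpha> w" "awalk u' \<beta> w"
  note sets = set_path_word[OF w(1)] set_path_word[OF w(2)] set_star_word[OF w(1)] set_star_word[OF w(2)]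
  have wv: "w \<in> verts E" using w(1) by auto
  have "mon j @ mon (dual j) @ mon j
      = path_word u \<alpha> @ (star_word u' \<beta> @ path_word u' \<beta>)
          @ (star_word u \<alpha> @ path_word u \<alpha> @ star_word u' \<beta>)"
    by (simp add: j)
  also have "\<dots> \<approx> path_word u \<alpha> @ [Vert w] @ (star_word u \<alpha> @ path_word u \<alpha> @ star_word u' \<beta>)"
    using sets by (intro word_eq_context star_word_path_word_same[OF w(2)]) simp_all
  also have "\<dots> = (path_word u \<alpha> @ [Vert w]) @ (star_word u \<alpha> @ path_word u \<alpha>) @ star_word u' \<beta>"
    by simp
  also have "\<dots> \<approx> (path_word u \<alpha> @ [Vert w]) @ [Vert w] @ star_word u' \<beta>"
    using sets wv by (intro word_eq_context star_word_path_word_same[OF w(1)]) simp_all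
  also have "\<dots> = [] @ (path_word u \<alpha> @ [Vert w]) @ ([Vert w] @ star_word u' \<beta>)"
    by simp
  also have "\<dots> \<approx> [] @ path_word u \<alpha> @ ([Vert w] @ star_word u' \<beta>)"
    using sets wv by (intro word_eq_context path_word_end[OF w(1)]) simp_all
  also have "\<dots> = path_word u \<alpha> @ ([Vert w] @ star_word u' \<beta>) @ []"
    by simp
  also have "\<dots> \<approx> path_word u \<alpha> @ star_word u' \<beta> @ []"
    using sets by (intro word_eq_context star_word_start[OF w(2)]) simp_all
  finally show ?thesis by (simp add: j)
qed

text \<open>For finite \<open>V\<close> and \<open>A\<close> this is a finite box, which the
  products of \<open>mon_product_increases\<close> do not leave.\<close>

definition bounded_monomials ::
    "int \<Rightarrow> 'v set \<Rightarrow> 'e set \<Rightarrow> nat \<Rightarrow> ('v \<times> 'e list \<times> 'v \<times> 'e list) set" where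
  "bounded_monomials i V A n = {(u, \<alpha>, u', \<beta>) \<in> monomials i.
     u \<in> V \<and> u' \<in> V \<and> set \<alpha> \<subseteq> A \<and> set \<beta> \<subseteq> A \<and> length \<alpha> \<le> n \<and> length \<beta> \<le> n}"

lemma bounded_monomials_subset: "bounded_monomials i V A n \<subseteq> monomials i"
  by (auto simp: bounded_monomials_def)

text \<open>
  The degree being fixed, the length of \<open>\<beta>\<close> determines that of \<open>\<alpha>\<close>.  The order within one length is
  immaterial and comes from an arbitrary enumeration \<open>ix\<close> of the finitely many paths involved.
\<close>

fun mon_key ::
    "('v \<times> 'e list \<Rightarrow> nat) \<Rightarrow> 'v \<times> 'e list \<times> 'v \<times> 'e list \<Rightarrow> nat \<times> nat \<times> nat" where
  "mon_key ix (u, \<alpha>, u', \<beta>) = (length \<beta>, ix (u, \<alpha>), ix (u', \<beta>))"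

text \<open>With \<open>l = \<alpha>\<beta>\<^sup>*\<close>,
  \<open>j = \<alpha>0\<beta>0\<^sup>*\<close> and \<open>m = \<gamma>\<delta>\<^sup>*\<close>, the
  product vanishes unless \<beta> = \<beta>0 \<tau> and \<gamma> = \<alpha>0 \<sigma>, when it
  reduces to \<open>\<alpha>\<tau>\<^sup>*\<sigma>\<delta>\<^sup>*\<close>. After cancellation the
  rest of \<tau> lengthens \<delta>, or that of \<sigma> lengthens \<alpha>.\<close>

lemma mon_product_increases:
  assumes j: "j \<in> bounded_monomials i V A n" and l: "l \<in> bounded_monomials i V A n"
    and m: "m \<in> bounded_monomials i V A n"
    and jl: "mon_key ix j \<le> mon_key ix l" and jm: "mon_key ix j \<le> mon_key ix m"
    and ne: "\<not> (l = j \<and> m = j)"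
    and ix: "inj_on ix (V \<times> {xs. set xs \<subseteq> A \<and> length xs \<le> n})"
  shows "vanishes (mon l @ mon (dual j) @ mon m)
    \<or> (\<exists>k\<in>bounded_monomials i V A n. mon_key ix j < mon_key ix k
         \<and> mon l @ mon (dual j) @ mon m \<approx> mon k)"
proof -
  obtain a \<alpha>0 b \<beta>0 w0 where j0: "j = (a, \<alpha>0, b, \<beta>0)" and wj: "awalk a \<alpha>0 w0" "awalk b \<beta>0 w0"
    and dj: "int (length \<alpha>0) - int (length \<beta>0) = i"
    using j bounded_monomials_subset by (blast elim: monomialsE)
  obtain c \<alpha> d \<beta> w1 where l0: "l = (c, \<alpha>, d, \<beta>)" and wl: "awalk c \<alpha> w1" "awalk d \<beta> w1"
    and dl: "int (length \<alpha>) - int (length \<beta>) = i"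
    using l bounded_monomials_subset by (blast elim: monomialsE)
  obtain e \<gamma> f \<delta> w2 where m0: "m = (e, \<gamma>, f, \<delta>)" and wm: "awalk e \<gamma> w2" "awalk f \<delta> w2"
    and dm: "int (length \<gamma>) - int (length \<delta>) = i"
    using m bounded_monomials_subset by (blast elim: monomialsE)
  note box = j[unfolded j0 bounded_monomials_def] l[unfolded l0 bounded_monomials_def]
    m[unfolded m0 bounded_monomials_def]
  note sets = set_path_word[OF wl(1)] set_star_word[OF wl(2)] set_path_word[OF wj(2)]
    set_star_word[OF wj(1)] set_path_word[OF wm(1)] set_star_word[OF wm(2)]
  have len: "length \<beta>0 \<le> length \<beta>" "length \<beta>0 \<le> length \<delta>"
    using jl jm by (auto simp: j0 l0 m0)
  \<comment> \<open>Since the degrees agree, the bound on ghost parts carries over to the real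
    parts.\<close>
  with dj dm have len': "length \<alpha>0 \<le> length \<gamma>" by linarith
  let ?X = "mon l @ mon (dual j) @ mon m"
  have X: "?X = path_word c \<alpha> @ (star_word d \<beta> @ path_word b \<beta>0)
      @ (star_word a \<alpha>0 @ path_word e \<gamma> @ star_word f \<delta>)"
    by (simp add: j0 l0 m0)
  have X': "?X = (path_word c \<alpha> @ star_word d \<beta> @ path_word b \<beta>0)
      @ (star_word a \<alpha>0 @ path_word e \<gamma>) @ star_word f \<delta>"
    by (simp add: j0 l0 m0)
  have left: "vanishes ?X" if "vanishes (star_word d \<beta> @ path_word b \<beta>0)"
    unfolding X using sets that by (intro word_null_context) simp_all
  have right: "vanishes ?X" if "vanishes (star_word a \<alpha>0 @ path_word e \<gamma>)"
    unfolding X' using sets that by (intro word_null_context) simp_all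
  consider (null) "vanishes ?X"
    | (ext) \<tau> \<sigma> where "d = b" "\<beta> = \<beta>0 @ \<tau>" "awalk w0 \<tau> w1"
        "star_word d \<beta> @ path_word b \<beta>0 \<approx> star_word w0 \<tau>"
        "e = a" "\<gamma> = \<alpha>0 @ \<sigma>" "awalk w0 \<sigma> w2"
        "star_word a \<alpha>0 @ path_word e \<gamma> \<approx> path_word w0 \<sigma>"
    using star_word_path_word_long[OF wl(2) wj(2) len(1)]
      star_word_long_path_word[OF wj(1) wm(1) len']
  proof (elim disjE exE conjE)
    assume "vanishes (star_word d \<beta> @ path_word b \<beta>0)"
    from left[OF this] show thesis by (rule null)
  next
    assume "vanishes (star_word d \<beta> @ path_word b \<beta>0)"
    from left[OF this] show thesis by (rule null)
  next
    assume "vanishes (star_word a \<alpha>0 @ path_word e \<gamma>)"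
    from right[OF this] show thesis by (rule null)
  next
    fix \<tau> \<sigma>
    assume "d = b" "\<beta> = \<beta>0 @ \<tau>" "awalk w0 \<tau> w1"
        "star_word d \<beta> @ path_word b \<beta>0 \<approx> star_word w0 \<tau>"
        "a = e" "\<gamma> = \<alpha>0 @ \<sigma>" "awalk w0 \<sigma> w2"
        "star_word a \<alpha>0 @ path_word e \<gamma> \<approx> path_word w0 \<sigma>"
    then show thesis by (intro ext) simp_all
  qed
  then show ?thesis
  proof cases
    case null
    then show ?thesis ..
  next
    case ext
    note sets' = sets set_star_word[OF ext(3)] set_path_word[OF ext(7)]
    have "?X \<approx> path_word c \<alpha> @ star_word w0 \<tau> @ (star_word a \<alpha>0 @ path_word e \<gamma> @ star_word f \<delta>)"
      unfolding X using sets by (intro word_eq_context ext(4)) simp_all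
    also have "\<dots> = (path_word c \<alpha> @ star_word w0 \<tau>) @ (star_word a \<alpha>0 @ path_word e \<gamma>) @ star_word f \<delta>"
      by simp
    also have "\<dots> \<approx> (path_word c \<alpha> @ star_word w0 \<tau>) @ path_word w0 \<sigma> @ star_word f \<delta>"
      using sets' by (intro word_eq_context ext(8)) simp_all
    also have "\<dots> = path_word c \<alpha> @ (star_word w0 \<tau> @ path_word w0 \<sigma>) @ star_word f \<delta>"
      by simp
    finally have Y: "?X \<approx> path_word c \<alpha> @ (star_word w0 \<tau> @ path_word w0 \<sigma>) @ star_word f \<delta>" .
    \<comment> \<open>If \<tau> and \<sigma> are empty, \<open>l\<close> and \<open>j\<close> share
      \<beta>0 while \<open>m\<close> and \<open>j\<close> share \<alpha>0, so each key inequality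
      compares one remaining path. Equality in both would give \<open>l = m = j\<close>, as
      \<open>ix\<close> is injective.\<close>
    have key: "ix (a, \<alpha>0) < ix (c, \<alpha>) \<or> ix (a, \<alpha>0) = ix (c, \<alpha>) \<and> ix (b, \<beta>0) < ix (f, \<delta>)"
      if "\<tau> = []" "\<sigma> = []"
    proof -
      have "length \<delta> = length \<beta>0" using dj dm ext(6) that by simp
      then have le: "ix (a, \<alpha>0) \<le> ix (c, \<alpha>)" "ix (b, \<beta>0) \<le> ix (f, \<delta>)"
        using jl jm that ext by (auto simp: j0 l0 m0)
      have "(a, \<alpha>0) = (c, \<alpha>)" if "ix (a, \<alpha>0) = ix (c, \<alpha>)"
        using box by (intro inj_onD[OF ix that]) auto
      moreover have "(b, \<beta>0) = (f, \<delta>)" if "ix (b, \<beta>0) = ix (f, \<delta>)"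
        using box by (intro inj_onD[OF ix that]) auto
      ultimately show ?thesis
        using le ne that ext by (fastforce simp: j0 l0 m0)
    qed
    show ?thesis
      using star_word_path_word[OF ext(3) ext(7)]
    proof (elim disjE exE conjE)
      assume "vanishes (star_word w0 \<tau> @ path_word w0 \<sigma>)"
      then have "vanishes (path_word c \<alpha> @ (star_word w0 \<tau> @ path_word w0 \<sigma>) @ star_word f \<delta>)"
        using sets by (intro word_null_context) simp_all
      then show ?thesis using word_null_cong[OF Y] by blast
    next
      fix \<rho>
      assume \<rho>: "\<tau> = \<sigma> @ \<rho>" "awalk w2 \<rho> w1"
        "star_word w0 \<tau> @ path_word w0 \<sigma> \<approx> star_word w2 \<rho>"
      let ?k = "(c, \<alpha>, f, \<delta> @ \<rho>)"
      note Y
      also have "path_word c \<alpha> @ (star_word w0 \<tau> @ path_word w0 \<sigma>) @ star_word f \<delta>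
          \<approx> path_word c \<alpha> @ star_word w2 \<rho> @ star_word f \<delta>"
        using sets by (intro word_eq_context \<rho>(3)) simp_all
      also have "\<dots> \<approx> mon ?k"
        using word_eq_context[OF star_word_append[OF wm(2) \<rho>(2)], of "path_word c \<alpha>" "[]"] sets
        by simp
      finally have "?X \<approx> mon ?k" .
      \<comment> \<open>Equal degrees make \<sigma> as long as \<delta> is in excess of \<beta>0. So
        the new ghost part has the length of \<beta>: it respects the bound \<open>n\<close> and
        exceeds \<beta>0 unless \<tau> is empty.\<close>
      moreover have lk: "length (\<delta> @ \<rho>) = length \<beta>"
        using dj dm ext(2,6) \<rho>(1) by simp
      moreover have "?k \<in> bounded_monomials i V A n"
        using box wl(1) awalk_appendI[OF wm(2) \<rho>(2)] dl lk ext(2) \<rho>(1)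
        by (auto simp: bounded_monomials_def monomials_def)
      moreover have "mon_key ix j < mon_key ix ?k"
      proof (cases "\<tau> = []")
        case True
        with key \<rho>(1) lk ext(2) show ?thesis by (auto simp: j0)
      next
        case False
        then have "length \<beta>0 < length \<beta>" using ext(2) by simp
        then show ?thesis using lk by (simp add: j0)
      qed
      ultimately show ?thesis by blast
    next
      fix \<rho>
      assume \<rho>: "\<sigma> = \<tau> @ \<rho>" "awalk w1 \<rho> w2"
        "star_word w0 \<tau> @ path_word w0 \<sigma> \<approx> path_word w1 \<rho>"
      let ?k = "(c, \<alpha> @ \<rho>, f, \<delta>)"
      note Y
      also have "path_word c \<alpha> @ (star_word w0 \<tau> @ path_word w0 \<sigma>) @ star_word f \<delta>
          \<approx> path_word c \<alpha> @ path_word w1 \<rho> @ star_word f \<delta>"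
        using sets by (intro word_eq_context \<rho>(3)) simp_all
      also have "\<dots> \<approx> mon ?k"
        using word_eq_context[OF path_word_append[OF wl(1) \<rho>(2)], of "[]" "star_word f \<delta>"] sets
        by simp
      finally have "?X \<approx> mon ?k" .
      \<comment> \<open>Here the ghost part stays \<delta>, which is longer than \<beta>0 unless
        \<sigma> is empty; the new real part is no longer than \<gamma>.\<close>
      moreover have lk: "length (\<alpha> @ \<rho>) = length \<gamma>"
        using dj dl ext(2,6) \<rho>(1) by simp
      moreover have "?k \<in> bounded_monomials i V A n"
        using box wm(2) awalk_appendI[OF wl(1) \<rho>(2)] dm lk ext(6) \<rho>(1)
        by (auto simp: bounded_monomials_def monomials_def)
      moreover have "mon_key ix j < mon_key ix ?k"
      proof (cases "\<sigma> = []")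
        case True
        then have "length \<delta> = length \<beta>0" using dj dm ext(6) by simp
        with True key \<rho>(1) show ?thesis by (auto simp: j0)
      next
        case False
        then have "length \<alpha>0 < length \<gamma>" using ext(6) by simp
        then have "length \<beta>0 < length \<delta>" using dj dm by linarith
        then show ?thesis by (simp add: j0)
      qed
      ultimately show ?thesis by blast
    qed
  qed
qed


section \<open>Elimination of the smallest monomial\<close>

lemma regular_if_remainder_regular:
  fixes p y t :: "('v, 'e, 'r) free_alg"
  assumes "p \<in> free_algebra E" "y \<in> free_algebra E" "t \<in> free_algebra E"
    and "z = p - p * y * p" "z - z * t * z \<in> lpa_ideal E"
  shows "\<exists>s\<in>free_algebra E. p - p * s * p \<in> lpa_ideal E"
proof -
  \<comment> \<open>This is \<open>y + (1 - y * p) * t * (1 - p * y)\<close>, multiplied out because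
    \<open>1\<close> is not in \<open>free_algebra E\<close>.\<close>
  let ?s = "y + t - y * p * t - t * p * y + y * p * t * p * y"
  have "p - p * ?s * p = z - z * t * z"
    unfolding assms(4) by (simp add: algebra_simps)
  moreover have "?s \<in> free_algebra E"
    using assms(1-3) by (intro free_algebra_add free_algebra_diff free_algebra_mult)
  ultimately show ?thesis using assms(5) by metis
qed

text \<open>Induction over upward closed subsets \<open>S\<close> of the box, starting from the
  whole box: monomials of the box larger than the minimum of \<open>S\<close> lie in
  \<open>S\<close>, and removing the minimum leaves an upward closed set.\<close>

lemma mon_span_regular:
  assumes reg: "von_neumann_regular R"
    and fin: "finite V" "finite A"
    and p: "p \<in> mon_span (bounded_monomials i V A n)"
  shows "\<exists>s\<in>free_algebra E. p - p * s * p \<in> lpa_ideal E"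
proof -
  let ?B = "bounded_monomials i V A n"
  let ?P = "V \<times> {xs. set xs \<subseteq> A \<and> length xs \<le> n}"
  have finP: "finite ?P"
    using fin finite_lists_length_le by blast
  have "?B \<subseteq> (\<lambda>((u, \<alpha>), u', \<beta>). (u, \<alpha>, u', \<beta>)) ` (?P \<times> ?P)"
    by (force simp: bounded_monomials_def)
  then have finB: "finite ?B"
    by (rule finite_subset) (intro finite_imageI finite_cartesian_product finP)
  obtain ix :: "'v \<times> 'e list \<Rightarrow> nat" where ix: "inj_on ix ?P"
    using finite_imp_inj_to_nat_seg[OF finP] by blast
  let ?key = "mon_key ix"
  \<comment> \<open>Ties are excluded, so that removing the minimum does preserve upward
    closure.\<close>
  have inj: "k = j" if "j \<in> ?B" "k \<in> ?B" "?key j = ?key k" for j k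
  proof -
    obtain u \<alpha> u' \<beta> where j: "j = (u, \<alpha>, u', \<beta>)" by (cases j)
    obtain v \<gamma> v' \<delta> where k: "k = (v, \<gamma>, v', \<delta>)" by (cases k)
    have "(u, \<alpha>) \<in> ?P" "(u', \<beta>) \<in> ?P" "(v, \<gamma>) \<in> ?P" "(v', \<delta>) \<in> ?P"
      using that(1,2) by (auto simp: j k bounded_monomials_def)
    moreover have "ix (u, \<alpha>) = ix (v, \<gamma>)" "ix (u', \<beta>) = ix (v', \<delta>)"
      using that(3) by (auto simp: j k)
    ultimately show ?thesis
      using ix by (simp add: j k inj_on_eq_iff)
  qed
  have "\<exists>s\<in>free_algebra E. p - p * s * p \<in> lpa_ideal E"
    if "S \<subseteq> ?B" "\<And>k l. k \<in> S \<Longrightarrow> l \<in> ?B \<Longrightarrow> ?key k \<le> ?key l \<Longrightarrow> l \<in> S" "p \<in> mon_span S" for S p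
    using that
  proof (induction "card S" arbitrary: S p rule: less_induct)
    case less
    have finS: "finite S" using less.prems(1) finB finite_subset by blast
    show ?case
    proof (cases "S = {}")
      case True
      then show ?thesis
        using less.prems(3) mon_span_empty free_algebra_zero by force
    next
      case False
      have "Min (?key ` S) \<in> ?key ` S" using False finS by simp
      then obtain j where j: "j \<in> S" and Minj: "?key j = Min (?key ` S)" by force
      have min: "?key j \<le> ?key k" if "k \<in> S" for k
        using that finS Minj by simp
      define S' where "S' = S - {j}"
      have S'B: "S' \<subseteq> ?B" and S: "S = insert j S'" and S'S: "S' \<subseteq> S"
        using less.prems(1) j by (auto simp: S'_def)
      have jB: "j \<in> ?B" and jm: "j \<in> monomials i"
        using j less.prems(1) bounded_monomials_subset by blast+
      have mS: "S \<subseteq> monomials i" "S' \<subseteq> monomials i"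
        using less.prems(1) S'B bounded_monomials_subset by blast+
      have up: "l \<in> S'" if "k \<in> S'" "l \<in> ?B" "?key k \<le> ?key l" for k l
      proof -
        have "l \<noteq> j"
        proof
          assume "l = j"
          then have "?key k = ?key j" using that min S'S by (meson order_antisym subsetD)
          then show False using inj[of j k] that jB S'B by (auto simp: S'_def)
        qed
        moreover have "l \<in> S"
          using less.prems(2)[OF _ that(2,3)] that(1) S'S by blast
        ultimately show ?thesis by (simp add: S'_def)
      qed
      have greater: "k \<in> S'" if "k \<in> ?B" "?key j < ?key k" for k
        using less.prems(2)[OF j that(1)] that(2) by (auto simp: S'_def)
      have step: "Poly_Mapping.single (mon l @ mon (dual j) @ mon m) c \<in> mon_span S'"
        if "l \<in> S" "m \<in> S" "\<not> (l = j \<and> m = j)" for l m c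
      proof -
        have "l \<in> ?B" "m \<in> ?B" using that less.prems(1) by auto
        from mon_product_increases[OF jB this min[OF that(1)] min[OF that(2)] that(3) ix]
        show ?thesis
          using greater mon_span_word_eq by (auto simp: word_null_def intro: mon_span.ideal)
      qed
      \<comment> \<open>One expansion of \<open>p\<close> is fixed; \<open>c\<close> depends on this
        choice and may be 0.\<close>
      obtain c q where q: "q \<in> mon_span S'" and pq: "p = Poly_Mapping.single (mon j) c + q"
        using mon_span_insert less.prems(3) unfolding S by blast
      obtain d where d: "c = c * d * c"
        using reg by (auto simp: von_neumann_regular_def)
      define e where "e = Poly_Mapping.single (mon j) c"
      define y where "y = Poly_Mapping.single (mon (dual j)) d"
      have e: "e \<in> mon_span {j}" by (auto simp: e_def intro: mon_span.mon)
      \<comment> \<open>The choice of \<open>d\<close> restores the coefficient, while the word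
        collapses to \<open>mon j\<close> only modulo the ideal.\<close>
      have "e * y * e = Poly_Mapping.single (mon j @ mon (dual j) @ mon j) c"
        using d by (simp add: e_def y_def single_word_mult)
      then have "e * y * e - e \<in> lpa_ideal E"
        using mon_dual_mon[OF jm] by (simp add: e_def word_eq_def)
      then have eye: "e * y * e - e \<in> mon_span S'" by (rule mon_span.ideal)
      \<comment> \<open>Each product has a factor \<open>q\<close>, whose monomials differ from
        \<open>j\<close>, so the excluded case \<open>l = m = j\<close> does not arise.\<close>
      have cross: "e * y * q \<in> mon_span S'" "q * y * e \<in> mon_span S'" "q * y * q \<in> mon_span S'"
        unfolding y_def using S'S j jm mS
        by (intro mon_span_product[OF e q] mon_span_product[OF q e] mon_span_product[OF q q] step;
            auto simp: S'_def)+
      have "q - ((e * y * e - e) + e * y * q + q * y * e + q * y * q) \<in> mon_span S'"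
        by (rule mon_span_diff[OF q mon_span.add[OF mon_span.add[OF mon_span.add[OF eye cross(1)]
              cross(2)] cross(3)]])
      moreover have "q - ((e * y * e - e) + e * y * q + q * y * e + q * y * q) = p - p * y * p"
        by (simp add: pq e_def[symmetric] algebra_simps)
      ultimately have z: "p - p * y * p \<in> mon_span S'" by simp
      have "card S' < card S" unfolding S'_def by (rule card_Diff1_less[OF finS j])
      then obtain t where t: "t \<in> free_algebra E"
        "(p - p * y * p) - (p - p * y * p) * t * (p - p * y * p) \<in> lpa_ideal E"
        using less.hyps[OF _ S'B _ z] up by metis
      show ?thesis
      proof (rule regular_if_remainder_regular[OF _ _ t(1) refl t(2)])
        show "p \<in> free_algebra E"
          using mon_span_subset_free_algebra[OF less.prems(3) mS(1)] .
        show "y \<in> free_algebra E"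
          unfolding y_def by (rule single_mon_in_free_algebra[OF dual_monomials[OF jm]])
      qed
    qed
  qed
  from this[of ?B p] show ?thesis using p by blast
qed


section \<open>Homogeneous elements\<close>

lemma lpa_class_word_eq:
  assumes "w \<approx> w'" "w \<noteq> []" "w' \<noteq> []" "set w \<subseteq> generators E" "set w' \<subseteq> generators E"
  shows "lpa_class E (Poly_Mapping.single w (c::'r)) = lpa_class E (Poly_Mapping.single w' c)"
  using assms
  by (subst lpa_class_eq_iff) (auto simp: word_eq_def intro: single_in_free_algebra)

text \<open>The first edge absorbs the extra source vertex of \<open>path_word\<close>, so the word
  computations apply to the graded components.\<close>

lemma lpa_path_eq:
  assumes "awalk u \<alpha> w"
  shows "lpa_path E u \<alpha> = lpa_class E (Poly_Mapping.single (path_word u \<alpha>) (1::'r))"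
proof (cases \<alpha>)
  case Nil
  then show ?thesis by (simp add: lpa_path_def path_word_def)
next
  case (Cons f \<alpha>')
  then have f: "f \<in> arcs E" "u = tail E f" "set \<alpha>' \<subseteq> arcs E"
    using assms by (auto simp: awalk_Cons_iff dest: awalk_arcs)
  have "[] @ [Vert (tail E f), Edge f] @ map Edge \<alpha>' \<approx> [] @ [Edge f] @ map Edge \<alpha>'"
    using f by (intro word_eq_context word_eq_relations) auto
  then have "path_word u \<alpha> \<approx> map Edge \<alpha>"
    by (simp add: path_word_def Cons f)
  then have "lpa_class E (Poly_Mapping.single (path_word u \<alpha>) (1::'r))
      = lpa_class E (Poly_Mapping.single (map Edge \<alpha>) 1)"
    using f set_path_word[OF assms]
    by (intro lpa_class_word_eq) (auto simp: Cons path_word_def)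
  then show ?thesis by (simp add: lpa_path_def Cons)
qed

lemma lpa_path_star_eq:
  assumes "awalk u \<beta> w"
  shows "lpa_path_star E u \<beta> = lpa_class E (Poly_Mapping.single (star_word u \<beta>) (1::'r))"
proof (cases \<beta>)
  case Nil
  then show ?thesis by (simp add: lpa_path_star_def star_word_def)
next
  case (Cons f \<beta>')
  then have f: "f \<in> arcs E" "u = tail E f" "set \<beta>' \<subseteq> arcs E"
    using assms by (auto simp: awalk_Cons_iff dest: awalk_arcs)
  have "map Ghost (rev \<beta>') @ [Ghost f, Vert (tail E f)] @ [] \<approx> map Ghost (rev \<beta>') @ [Ghost f] @ []"
    using f by (intro word_eq_context word_eq_relations) auto
  then have "star_word u \<beta> \<approx> map Ghost (rev \<beta>)"
    by (simp add: star_word_def Cons f)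
  then have "lpa_class E (Poly_Mapping.single (star_word u \<beta>) (1::'r))
      = lpa_class E (Poly_Mapping.single (map Ghost (rev \<beta>)) 1)"
    using f set_star_word[OF assms]
    by (intro lpa_class_word_eq) (auto simp: Cons star_word_def)
  then show ?thesis by (simp add: lpa_path_star_def Cons)
qed

text \<open>Each word absorbs its range vertex; inserting both puts two different, hence orthogonal,
  vertices side by side.\<close>

lemma path_word_star_word_null:
  assumes "awalk u \<alpha> w" "awalk u' \<beta> w'" "w \<noteq> w'"
  shows "vanishes (path_word u \<alpha> @ star_word u' \<beta>)"
proof -
  have v: "w \<in> verts E" "w' \<in> verts E" using assms by auto
  note sets = set_path_word[OF assms(1)] set_star_word[OF assms(2)]
  have "[] @ path_word u \<alpha> @ star_word u' \<beta> \<approx> [] @ (path_word u \<alpha> @ [Vert w]) @ star_word u' \<beta>"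
    using sets by (intro word_eq_context word_eq_sym[OF path_word_end[OF assms(1)]]) simp_all
  also have "\<dots> = (path_word u \<alpha> @ [Vert w]) @ star_word u' \<beta> @ []"
    by simp
  also have "\<dots> \<approx> (path_word u \<alpha> @ [Vert w]) @ ([Vert w'] @ star_word u' \<beta>) @ []"
    using sets v by (intro word_eq_context word_eq_sym[OF star_word_start[OF assms(2)]]) simp_all
  also have "\<dots> = path_word u \<alpha> @ [Vert w, Vert w'] @ star_word u' \<beta>"
    by simp
  finally have "path_word u \<alpha> @ star_word u' \<beta> \<approx> path_word u \<alpha> @ [Vert w, Vert w'] @ star_word u' \<beta>"
    by simp
  moreover have "vanishes (path_word u \<alpha> @ [Vert w, Vert w'] @ star_word u' \<beta>)"
    using sets v assms(3) by (intro word_null_context word_null_relations) simp_all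
  ultimately show ?thesis by (rule word_null_cong)
qed

text \<open>Elimination works on representatives. Generators whose paths end at different vertices
  fall into the ideal, which leaves \<open>monomials i\<close>.\<close>

lemma lpa_component_mon_span:
  assumes "X \<in> lpa_component E i"
  shows "\<exists>p\<in>mon_span (monomials i). X = lpa_class E p"
  using assms unfolding lpa_component_def
proof (induction rule: lpa_span.induct)
  case zero
  show ?case using mon_span.ideal[OF lpa_ideal.zero] by blast
next
  case (scale X c)
  then obtain u \<alpha> w u' \<beta> w' where X: "X = lpa_mult E (lpa_path E u \<alpha>) (lpa_path_star E u' \<beta>)"
    and w: "awalk u \<alpha> w" "awalk u' \<beta> w'" and i: "int (length \<alpha>) - int (length \<beta>) = i"
    by blast
  let ?pq = "path_word u \<alpha> @ star_word u' \<beta>"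
  have "path_word u \<alpha> \<noteq> []" "star_word u' \<beta> \<noteq> []"
    by (simp_all add: path_word_def star_word_def)
  with set_path_word[OF w(1)] set_star_word[OF w(2)]
  have free: "Poly_Mapping.single (path_word u \<alpha>) (1::'r) \<in> free_algebra E"
      "Poly_Mapping.single (star_word u' \<beta>) (1::'r) \<in> free_algebra E"
      "Poly_Mapping.single ?pq (1::'r) \<in> free_algebra E"
    by (auto intro!: single_in_free_algebra)
  have "lpa_scale E c X = lpa_class E (Poly_Mapping.single ?pq c)"
    by (simp add: X lpa_path_eq[OF w(1)] lpa_path_star_eq[OF w(2)] lpa_class_mult free
        lpa_class_scale single_word_mult scalar_mult_single)
  moreover have "Poly_Mapping.single ?pq c \<in> mon_span (monomials i)"
  proof (cases "w = w'")
    case True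
    then show ?thesis
      using mon_span.mon[of "(u, \<alpha>, u', \<beta>)" "monomials i" c] w i by (auto simp: monomials_def)
  next
    case False
    then show ?thesis
      using path_word_star_word_null[OF w] by (auto simp: word_null_def intro: mon_span.ideal)
  qed
  ultimately show ?case by blast
next
  case (add X Y)
  then obtain p q where pq: "p \<in> mon_span (monomials i)" "X = lpa_class E p"
      "q \<in> mon_span (monomials i)" "Y = lpa_class E q"
    by blast
  then have "lpa_add E X Y = lpa_class E (p + q)"
    using mon_span_subset_free_algebra[OF _ order_refl] by (simp add: lpa_class_add)
  then show ?case using pq mon_span.add by blast
qed

lemma finite_subset_bounded_monomials:
  assumes "finite F" "F \<subseteq> monomials i"
  obtains V A n where "finite V" "finite A" "F \<subseteq> bounded_monomials i V A n"
proof
  let ?V = "(\<lambda>(u, \<alpha>, u', \<beta>). u) ` F \<union> (\<lambda>(u, \<alpha>, u', \<beta>). u') ` F"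
  let ?A = "\<Union>(u, \<alpha>, u', \<beta>)\<in>F. set \<alpha> \<union> set \<beta>"
  \<comment> \<open>The sum of all lengths bounds each of them and makes sense for empty
    \<open>F\<close> too.\<close>
  let ?n = "\<Sum>(u, \<alpha>, u', \<beta>)\<in>F. length \<alpha> + length \<beta>"
  show "finite ?V" "finite ?A" using assms(1) by auto
  show "F \<subseteq> bounded_monomials i ?V ?A ?n"
  proof
    fix j assume j: "j \<in> F"
    obtain u \<alpha> u' \<beta> where j0: "j = (u, \<alpha>, u', \<beta>)" by (cases j)
    have "length \<alpha> + length \<beta> \<le> ?n"
      using member_le_sum[OF j, of "\<lambda>(u, \<alpha>, u', \<beta>). length \<alpha> + length \<beta>"] assms(1)
      by (simp add: j0)
    moreover have "u \<in> ?V" "u' \<in> ?V" "set \<alpha> \<subseteq> ?A" "set \<beta> \<subseteq> ?A"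
      using j unfolding j0 by force+
    moreover have "(u, \<alpha>, u', \<beta>) \<in> monomials i" using j assms(2) j0 by blast
    ultimately show "j \<in> bounded_monomials i ?V ?A ?n"
      unfolding bounded_monomials_def j0 by auto
  qed
qed

section \<open>Regularity of homogeneous elements\<close>

lemma graded_if_von_neumann_regular:
  assumes reg: "von_neumann_regular R"
  shows "graded_von_neumann_regular (lpa R E) (lpa_mult E) (lpa_component E)"
  unfolding graded_von_neumann_regular_def
proof (intro allI ballI)
  fix i and X :: "('v, 'e, 'r) lpa_elem"
  assume "X \<in> lpa_component E i"
  then obtain p where p: "p \<in> mon_span (monomials i)" and X: "X = lpa_class E p"
    using lpa_component_mon_span by blast
  obtain F where F: "F \<subseteq> monomials i" "finite F" "p \<in> mon_span F"
    using mon_span_finite[OF p] by blast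
  obtain V A n where "finite V" "finite A" "F \<subseteq> bounded_monomials i V A n"
    using finite_subset_bounded_monomials[OF F(2,1)] .
  with F(3) obtain s where s: "s \<in> free_algebra E" "p - p * s * p \<in> lpa_ideal E"
    using mon_span_regular[OF reg] mon_span_mono by metis
  have free: "p \<in> free_algebra E"
    using mon_span_subset_free_algebra[OF p] by blast
  have "X = lpa_mult E (lpa_mult E X (lpa_class E s)) X"
    using s free by (simp add: X lpa_class_mult free_algebra_mult lpa_class_eq_iff)
  moreover have "lpa_class E s \<in> lpa R E"
    using s(1) by (simp add: lpa_def lpa_class_def quotientI)
  ultimately show "\<exists>s\<in>lpa R E. X = lpa_mult E (lpa_mult E X s) X" by blast
qed

end


theorem theorem1p4:
  fixes E :: "('v, 'e) pre_digraph"
  assumes "wf_digraph E" and "verts E \<noteq> {}"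
  shows "graded_von_neumann_regular (lpa TYPE('r::ring_1) E) (lpa_mult E) (lpa_component E)
     \<longleftrightarrow> von_neumann_regular TYPE('r)"
proof
  interpret leavitt_algebra E "TYPE('r)"
    using assms(1) by (simp add: leavitt_algebra_def)
  assume "von_neumann_regular TYPE('r)"
  then show "graded_von_neumann_regular (lpa TYPE('r) E) (lpa_mult E) (lpa_component E)"
    by (rule graded_if_von_neumann_regular)
next
  \<comment> \<open>Non-emptiness of the graph enters here: a vertex \<open>v\<close> is needed to
    form the elements \<open>x v\<close>.\<close>
  obtain v where "v \<in> verts E" using assms(2) by blast
  then show "graded_von_neumann_regular (lpa TYPE('r) E) (lpa_mult E) (lpa_component E)
      \<Longrightarrow> von_neumann_regular TYPE('r)"
    by (rule wf_digraph.von_neumann_regular_if_graded[OF assms(1)])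
qed

end
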